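(* For $n\ge1$ let $J_n=\{\{1\},\ldots,\{n\}\}$, the noncrossing partition of $[n]$ all of whose blocks are singletons. The algebra morphism $$\Phi_{\mathrm{FdB}}:(H_{\mathrm{FdB}},m,\Delta)\longrightarrow(\mathbb{K}[\mathcal{NCP}],\cdot,\Delta),\qquad x_n\longmapsto J_n\quad(n\ge1),$$ is a Hopf algebra morphism.
   Context: $\mathbb{K}$ is a field of characteristic zero and $[n]=\{1,\ldots,n\}$. Faà di Bruno Hopf algebra. $G_{\mathrm{FdB}}=\{x+\sum_{n\ge1}a_nx^{n+1}\mid a_n\in\mathbb{K}\}$ is the group of formal series under composition. For $n\ge1$, $x_n:G_{\mathrm{FdB}}\to\mathbb{K}$ sends $x+\sum_k a_kx^{k+1}$ to $a_n$. $H_{\mathrm{FdB}}=\mathbb{K}[x_n\mid n\ge1]$ is the polynomial algebra generated by these maps, with the coproduct (algebra morphism) determined by $\Delta(x_n)(f,g)=x_n(f\circ g)$ for all $f,g\in G_{\mathrm{FdB}}$ (identifying elements of $H_{\mathrm{FdB}}\otimes H_{\mathrm{FdB}}$ with functions on $G_{\mathrm{FdB}}\times G_{\mathrm{FdB}}$). Noncrossing partitions. A noncrossing partition is a partition $\pi$ of a set $[n]$, $n\ge1$, into nonempty blocks such that there are no distinct blocks $b\ne b'$ and $x,z\in b$, $y,t\in b'$ with $x<y<z<t$. $\mathcal{NCP}$ is the set of all of them. If $Y$ is a nonempty set of blocks of $\pi$, $\pi_{\mid Y}$ is the noncrossing partition obtained by deleting the blocks not in $Y$ and renumbering the remaining elements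 increasingly; $\pi_{\mid\emptyset}=1$. The nesting order on the blocks of $\pi$ is $b\le_\pi b'\iff b'\subseteq[\min b,\max b]$. An ideal of $\pi$ is a set $J$ of blocks such that $b\in J$ and $b\le_\pi b'$ imply $b'\in J$. If $J$ is an ideal, the union of its blocks decomposes into maximal subsets of consecutive integers $I_1,\ldots,I_k$, each a union of blocks, and $\pi_{\mid_\cdot J}=\prod_i\pi_{\mid I_i}$ (restriction to the blocks contained in $I_i$; product $\cdot$ below). $\mathbb{K}[\mathcal{NCP}]$ is the free commutative algebra generated by $\mathcal{NCP}$, with product $\cdot$ and unit the empty monomial $1$. Its coproduct is the algebra morphism given on a noncrossing partition $\pi$ by $\Delta(\pi)=\sum_{J\text{ ideal of }\pi}\pi_{\mid\pi\setminus J}\otimes\pi_{\mid_\cdot J}$. It is a Hopf algebra with counit $\varepsilon_\Delta(\pi)=0$ for $\pi\in\mathcal{NCP}$. *)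

theory Defs
  imports
    "HOL-Library.Poly_Mapping"
    "HOL-Library.Product_Plus"
    "HOL-Library.Disjoint_Sets"
    "HOL-Computational_Algebra.Formal_Power_Series"
begin

section \<open>Free commutative algebras and their tensor squares\<close>

text \<open>
  For a commutative monoid \<open>'m\<close> (written additively), \<^typ>\<open>'m \<Rightarrow>\<^sub>0 'k\<close> is the monoid algebra,
  with basis \<open>Poly_Mapping.single m 1\<close> and unit map \<open>c \<mapsto> Poly_Mapping.single 0 c\<close>.
  The polynomial algebra on the set of variables \<open>'v\<close> is the case \<open>'m = 'v \<Rightarrow>\<^sub>0 nat\<close>.
\<close>

type_synonym ('v, 'k) free_calg = "('v \<Rightarrow>\<^sub>0 nat) \<Rightarrow>\<^sub>0 'k"

definition gen :: "'v \<Rightarrow> ('v, 'k::comm_ring_1) free_calg" where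
  "gen v = Poly_Mapping.single (Poly_Mapping.single v 1) 1"

definition scale :: "'k::comm_ring_1 \<Rightarrow> ('m::comm_monoid_add \<Rightarrow>\<^sub>0 'k) \<Rightarrow> ('m \<Rightarrow>\<^sub>0 'k)" where
  "scale c p = Poly_Mapping.single 0 c * p"

definition algebra_hom ::
  "('k::field \<Rightarrow> 'a::comm_ring_1 \<Rightarrow> 'a) \<Rightarrow> ('k \<Rightarrow> 'b::comm_ring_1 \<Rightarrow> 'b) \<Rightarrow> ('a \<Rightarrow> 'b) \<Rightarrow> bool" where
  "algebra_hom sA sB F \<longleftrightarrow>
     Vector_Spaces.linear sA sB F \<and> F 1 = 1 \<and> (\<forall>p q. F (p * q) = F p * F q)"

text \<open>The algebra morphism from a polynomial algebra, with \<open>gen v \<mapsto> h v\<close>, into an algebra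
  with scalar multiplication \<open>s\<close>.\<close>

definition subst ::
  "('k \<Rightarrow> 'a \<Rightarrow> 'a) \<Rightarrow> ('v \<Rightarrow> 'a) \<Rightarrow> ('v, 'k::comm_ring_1) free_calg \<Rightarrow> 'a::comm_ring_1" where
  "subst s h p = (\<Sum>m\<in>Poly_Mapping.keys p.
     s (Poly_Mapping.lookup p m) (\<Prod>v\<in>Poly_Mapping.keys m. h v ^ Poly_Mapping.lookup m v))"

definition lin_ext ::
  "('m \<Rightarrow> ('n::comm_monoid_add \<Rightarrow>\<^sub>0 'k)) \<Rightarrow> ('m \<Rightarrow>\<^sub>0 'k::comm_ring_1) \<Rightarrow> ('n \<Rightarrow>\<^sub>0 'k)" where
  "lin_ext h p = (\<Sum>m\<in>Poly_Mapping.keys p. scale (Poly_Mapping.lookup p m) (h m))"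

text \<open>
  The tensor product of the monoid algebras of \<open>'m\<close> and \<open>'n\<close> is realised as the monoid algebra
  of \<open>'m \<times> 'n\<close>: the pair \<open>(m, n)\<close> stands for the basis element \<open>m \<otimes> n\<close>, and the componentwise
  addition on pairs yields \<open>(p \<otimes> q) * (p' \<otimes> q') = p * p' \<otimes> q * q'\<close>.
\<close>

definition tensor ::
  "('m::comm_monoid_add \<Rightarrow>\<^sub>0 'k::comm_ring_1) \<Rightarrow> ('n::comm_monoid_add \<Rightarrow>\<^sub>0 'k) \<Rightarrow> ('m \<times> 'n \<Rightarrow>\<^sub>0 'k)"
  (infixr \<open>\<otimes>\<close> 75) where
  "p \<otimes> q = lin_ext (\<lambda>m. lin_ext (\<lambda>n. Poly_Mapping.single (m, n) 1) q) p"

lemma lookup_scale: "Poly_Mapping.lookup (scale c p) m = c * Poly_Mapping.lookup p m"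
  unfolding scale_def
  by (simp add: mult_map_scale_conv_mult[symmetric] Poly_Mapping.map.rep_eq when_def)

lemma lookup_lin_ext: "Poly_Mapping.lookup (lin_ext h p) k = 
    (\<Sum>m\<in>Poly_Mapping.keys p. Poly_Mapping.lookup p m * Poly_Mapping.lookup (h m) k)"
  unfolding lin_ext_def by (simp add: Poly_Mapping.lookup_sum lookup_scale)

lemma lookup_tensor:
  fixes p :: "'m::comm_monoid_add \<Rightarrow>\<^sub>0 'k::comm_ring_1" and q :: "'n::comm_monoid_add \<Rightarrow>\<^sub>0 'k"
  shows "Poly_Mapping.lookup (p \<otimes> q) (m, n) = Poly_Mapping.lookup p m * Poly_Mapping.lookup q n"
proof -
  have A: "(\<Sum>n'\<in>Poly_Mapping.keys q. Poly_Mapping.lookup q n' *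
      Poly_Mapping.lookup (Poly_Mapping.single (m', n') 1) (m, n)) = (if m' = m then Poly_Mapping.lookup q n else 0)" for m'
    by (auto simp: Poly_Mapping.lookup_single when_def if_distrib cong: if_cong)
      (auto simp: Poly_Mapping.in_keys_iff)
  show ?thesis unfolding tensor_def lookup_lin_ext A
    by (auto simp: if_distrib in_keys_iff cong: if_cong)
qed

definition tensor_map ::
  "(('m \<Rightarrow>\<^sub>0 'k) \<Rightarrow> ('m'::comm_monoid_add \<Rightarrow>\<^sub>0 'k)) \<Rightarrow> (('n \<Rightarrow>\<^sub>0 'k) \<Rightarrow> ('n'::comm_monoid_add \<Rightarrow>\<^sub>0 'k))
    \<Rightarrow> ('m \<times> 'n \<Rightarrow>\<^sub>0 'k::comm_ring_1) \<Rightarrow> ('m' \<times> 'n' \<Rightarrow>\<^sub>0 'k)" where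
  "tensor_map F G =
     lin_ext (\<lambda>(m, n). F (Poly_Mapping.single m 1) \<otimes> G (Poly_Mapping.single n 1))"

definition mult_map :: "('m::comm_monoid_add \<times> 'm \<Rightarrow>\<^sub>0 'k::comm_ring_1) \<Rightarrow> ('m \<Rightarrow>\<^sub>0 'k)" where
  "mult_map = lin_ext (\<lambda>(m, n). Poly_Mapping.single m 1 * Poly_Mapping.single n 1)"


section \<open>Hopf algebra morphisms\<close>

definition is_antipode ::
  "(('m \<Rightarrow>\<^sub>0 'k) \<Rightarrow> ('m \<times> 'm \<Rightarrow>\<^sub>0 'k)) \<Rightarrow> (('m \<Rightarrow>\<^sub>0 'k) \<Rightarrow> 'k)
    \<Rightarrow> (('m::comm_monoid_add \<Rightarrow>\<^sub>0 'k::field) \<Rightarrow> ('m \<Rightarrow>\<^sub>0 'k)) \<Rightarrow> bool" where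
  "is_antipode \<Delta> \<epsilon> S \<longleftrightarrow>
     Vector_Spaces.linear scale scale S \<and>
     (\<forall>p. mult_map (tensor_map S id (\<Delta> p)) = Poly_Mapping.single 0 (\<epsilon> p)) \<and>
     (\<forall>p. mult_map (tensor_map id S (\<Delta> p)) = Poly_Mapping.single 0 (\<epsilon> p))"

text \<open>An antipode is unique if it exists, so quantifying over them in the last clause amounts to
  compatibility with the antipodes of the two Hopf algebras.\<close>

definition hopf_algebra_hom ::
  "(('m::comm_monoid_add \<Rightarrow>\<^sub>0 'k::field) \<Rightarrow> ('m \<times> 'm \<Rightarrow>\<^sub>0 'k)) \<Rightarrow> (('m \<Rightarrow>\<^sub>0 'k) \<Rightarrow> 'k)
    \<Rightarrow> (('n::comm_monoid_add \<Rightarrow>\<^sub>0 'k) \<Rightarrow> ('n \<times> 'n \<Rightarrow>\<^sub>0 'k)) \<Rightarrow> (('n \<Rightarrow>\<^sub>0 'k) \<Rightarrow> 'k)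
    \<Rightarrow> (('m \<Rightarrow>\<^sub>0 'k) \<Rightarrow> ('n \<Rightarrow>\<^sub>0 'k)) \<Rightarrow> bool" where
  "hopf_algebra_hom \<Delta> \<epsilon> \<Delta>' \<epsilon>' F \<longleftrightarrow>
     algebra_hom scale scale F \<and>
     (\<forall>p. \<Delta>' (F p) = tensor_map F F (\<Delta> p)) \<and>
     (\<forall>p. \<epsilon>' (F p) = \<epsilon> p) \<and>
     (\<forall>S S'. is_antipode \<Delta> \<epsilon> S \<longrightarrow> is_antipode \<Delta>' \<epsilon>' S' \<longrightarrow> (\<forall>p. F (S p) = S' (F p)))"


section \<open>The Faa di Bruno Hopf algebra\<close>

typedef pos = "{n::nat. n \<ge> 1}"
  by auto

type_synonym 'k H_FdB = "(pos, 'k) free_calg"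

definition G_FdB :: "'k::field_char_0 fps set" where
  "G_FdB = {f. fps_nth f 0 = 0 \<and> fps_nth f 1 = 1}"

definition coord :: "nat \<Rightarrow> 'k::field_char_0 fps \<Rightarrow> 'k" where
  "coord n f = fps_nth f (n + 1)"

definition fdb_x :: "nat \<Rightarrow> 'k::field_char_0 H_FdB" where
  "fdb_x n = gen (Abs_pos n)"

text \<open>\<open>H_FdB\<close> and its tensor square as functions on \<open>G_FdB\<close> and on \<open>G_FdB \<times> G_FdB\<close>.\<close>

definition fdb_eval :: "'k H_FdB \<Rightarrow> 'k::field_char_0 fps \<Rightarrow> 'k" where
  "fdb_eval p f = subst (*) (\<lambda>v. coord (Rep_pos v) f) p"

definition fdb_eval2 ::
  "((pos \<Rightarrow>\<^sub>0 nat) \<times> (pos \<Rightarrow>\<^sub>0 nat) \<Rightarrow>\<^sub>0 'k) \<Rightarrow> 'k::field_char_0 fps \<Rightarrow> 'k fps \<Rightarrow> 'k" where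
  "fdb_eval2 t f g = (\<Sum>(m, n)\<in>Poly_Mapping.keys t. Poly_Mapping.lookup t (m, n) *
     (fdb_eval (Poly_Mapping.single m 1) f * fdb_eval (Poly_Mapping.single n 1) g))"

definition fdb_coproduct ::
  "'k::field_char_0 H_FdB \<Rightarrow> ((pos \<Rightarrow>\<^sub>0 nat) \<times> (pos \<Rightarrow>\<^sub>0 nat) \<Rightarrow>\<^sub>0 'k)" where
  "fdb_coproduct = (THE \<Delta>. algebra_hom scale scale \<Delta> \<and>
     (\<forall>n\<ge>1. \<forall>f\<in>G_FdB. \<forall>g\<in>G_FdB. fdb_eval2 (\<Delta> (fdb_x n)) f g = coord n (f oo g)))"

text \<open>The counit is evaluation at the neutral element of \<open>G_FdB\<close>.\<close>

definition fdb_counit :: "'k::field_char_0 H_FdB \<Rightarrow> 'k" where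
  "fdb_counit p = fdb_eval p fps_X"


section \<open>Noncrossing partitions\<close>

definition noncrossing :: "nat set set \<Rightarrow> bool" where
  "noncrossing P \<longleftrightarrow> \<not> (\<exists>b\<in>P. \<exists>b'\<in>P. b \<noteq> b' \<and>
     (\<exists>x\<in>b. \<exists>z\<in>b. \<exists>y\<in>b'. \<exists>t\<in>b'. x < y \<and> y < z \<and> z < t))"

definition singletons :: "nat \<Rightarrow> nat set set" where
  "singletons n = (\<lambda>i. {i}) ` {1..n}"

lemma singletons_noncrossing:
  "partition_on {1..n} (singletons n)" "noncrossing (singletons n)"
  by (auto simp: partition_on_def singletons_def disjoint_def noncrossing_def)

typedef ncp = "{P :: nat set set. (\<exists>n\<ge>1. partition_on {1..n} P) \<and> noncrossing P}"
  morphisms blocks Abs_ncp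
  using singletons_noncrossing[of 1] by blast

definition J_ncp :: "nat \<Rightarrow> ncp" where
  "J_ncp n = Abs_ncp (singletons n)"

lemma blocks_J_ncp: "n \<ge> 1 \<Longrightarrow> blocks (J_ncp n) = singletons n"
  unfolding J_ncp_def using singletons_noncrossing by (intro Abs_ncp_inverse) auto

definition renumber :: "nat set set \<Rightarrow> nat set set" where
  "renumber Y = (\<lambda>b. (\<lambda>i. card {j \<in> \<Union>Y. j \<le> i}) ` b) ` Y"

lemma renumber_noncrossing:
  assumes Y: "Y \<subseteq> blocks \<pi>" "Y \<noteq> {}"
  shows "partition_on {1..card (\<Union>Y)} (renumber Y)" "noncrossing (renumber Y)"
    and "card (\<Union>Y) \<ge> 1" and "blocks (Abs_ncp (renumber Y)) = renumber Y"
proof -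
  define U where "U = \<Union>Y"
  define r where "r = (\<lambda>i. card {j \<in> U. j \<le> i})"
  obtain n where n: "partition_on {1..n} (blocks \<pi>)" and nc: "noncrossing (blocks \<pi>)"
    using blocks[of \<pi>] by auto
  have U: "partition_on U Y"
    unfolding partition_on_def U_def
    using pairwise_subset[OF partition_onD2[OF n] Y(1)] partition_onD3[OF n] Y(1) by auto
  have "U \<subseteq> {1..n}"
    using partition_onD1[OF n] Y(1) by (auto simp: U_def)
  then have fin: "finite U"
    by (rule finite_subset) simp
  have mono: "r i < r j" if "i < j" "j \<in> U" for i j
    unfolding r_def
  proof (rule psubset_card_mono)
    have "j \<in> {k \<in> U. k \<le> j}" "j \<notin> {k \<in> U. k \<le> i}" using that by auto
    then show "{k \<in> U. k \<le> i} \<subset> {k \<in> U. k \<le> j}" using that by fastforce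
  qed (use fin in simp)
  have mono_le: "r i \<le> r j" if "i \<le> j" for i j
    unfolding r_def using that fin by (intro card_mono) auto
  have less: "i < j" if "r i < r j" for i j
    using that mono_le[of j i] by (meson leD not_le)
  have inj: "inj_on r U"
    by (rule inj_onI) (metis less_irrefl linorder_neqE_nat mono)
  have "r ` U = {1..card U}"
  proof (rule card_subset_eq)
    show "r ` U \<subseteq> {1..card U}"
    proof clarify
      fix i assume "i \<in> U"
      then have "{j \<in> U. j \<le> i} \<noteq> {}" by auto
      then have "r i > 0" unfolding r_def using fin by (simp add: card_gt_0_iff)
      moreover have "r i \<le> card U" unfolding r_def by (rule card_mono[OF fin]) auto
      ultimately show "r i \<in> {1..card U}" by simp
    qed
    show "card (r ` U) = card {1..card U}" using card_image[OF inj] by simp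
  qed simp
  moreover have ren: "renumber Y = (\<lambda>b. r ` b) ` Y"
    unfolding renumber_def r_def U_def by simp
  moreover have "{} \<notin> (\<lambda>b. r ` b) ` Y"
    using partition_onD3[OF U] by auto
  ultimately have p: "partition_on {1..card U} (renumber Y)"
    using partition_on_inj_image[OF U inj] by simp
  have q: "noncrossing (renumber Y)"
    unfolding noncrossing_def ren
  proof clarify
    fix b b' x y z t
    assume b: "b \<in> Y" "b' \<in> Y" "r ` b \<noteq> r ` b'"
      and xs: "x \<in> b" "z \<in> b" "y \<in> b'" "t \<in> b'"
      and lt: "r x < r y" "r y < r z" "r z < r t"
    have "\<exists>x\<in>b. \<exists>z\<in>b. \<exists>y\<in>b'. \<exists>t\<in>b'. x < y \<and> y < z \<and> z < t"
      by (intro bexI[OF _ xs(1)] bexI[OF _ xs(2)] bexI[OF _ xs(3)] bexI[OF _ xs(4)] conjI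
          less[OF lt(1)] less[OF lt(2)] less[OF lt(3)])
    moreover have "b \<in> blocks \<pi>" "b' \<in> blocks \<pi>" "b \<noteq> b'"
      using b Y(1) by auto
    ultimately show False
      using nc unfolding noncrossing_def by metis
  qed
  have "U \<noteq> {}"
    using partition_onD3[OF U] Y(2) by (auto simp: U_def)
  then have c: "card U \<ge> 1"
    using fin by (simp add: Suc_le_eq card_gt_0_iff)
  show "partition_on {1..card (\<Union>Y)} (renumber Y)" "noncrossing (renumber Y)" "card (\<Union>Y) \<ge> 1"
    using p q c by (simp_all add: U_def)
  have "renumber Y \<in> {P. (\<exists>n\<ge>1. partition_on {1..n} P) \<and> noncrossing P}"
    using q exI[of "\<lambda>n. n \<ge> 1 \<and> partition_on {1..n} (renumber Y)", OF conjI[OF c p]] by simp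
  then show "blocks (Abs_ncp (renumber Y)) = renumber Y"
    by (rule Abs_ncp_inverse)
qed

text \<open>The restriction to a set of blocks, as a monomial: the empty restriction is \<open>1\<close>.\<close>

definition restrict_blocks :: "nat set set \<Rightarrow> (ncp, 'k::comm_ring_1) free_calg" where
  "restrict_blocks Y = (if Y = {} then 1 else gen (Abs_ncp (renumber Y)))"

definition nesting_le :: "nat set \<Rightarrow> nat set \<Rightarrow> bool" where
  "nesting_le b b' \<longleftrightarrow> b' \<subseteq> {Min b..Max b}"

definition ideals :: "ncp \<Rightarrow> nat set set set" where
  "ideals \<pi> = {J. J \<subseteq> blocks \<pi> \<and> (\<forall>b\<in>J. \<forall>b'\<in>blocks \<pi>. nesting_le b b' \<longrightarrow> b' \<in> J)}"

definition consecutive :: "nat set \<Rightarrow> bool" where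
  "consecutive I \<longleftrightarrow> (\<exists>a b. a \<le> b \<and> I = {a..b})"

definition runs :: "nat set \<Rightarrow> nat set set" where
  "runs U = {I. consecutive I \<and> I \<subseteq> U \<and>
     (\<forall>I'. consecutive I' \<and> I' \<subseteq> U \<and> I \<subseteq> I' \<longrightarrow> I' = I)}"

definition restrict_dot :: "ncp \<Rightarrow> nat set set \<Rightarrow> (ncp, 'k::comm_ring_1) free_calg" where
  "restrict_dot \<pi> J = (\<Prod>I\<in>runs (\<Union>J). restrict_blocks {b \<in> blocks \<pi>. b \<subseteq> I})"

type_synonym 'k ncp_alg = "(ncp, 'k) free_calg"

definition ncp_coproduct ::
  "'k::field_char_0 ncp_alg \<Rightarrow> ((ncp \<Rightarrow>\<^sub>0 nat) \<times> (ncp \<Rightarrow>\<^sub>0 nat) \<Rightarrow>\<^sub>0 'k)" where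
  "ncp_coproduct = subst scale
     (\<lambda>\<pi>. \<Sum>J\<in>ideals \<pi>. restrict_blocks (blocks \<pi> - J) \<otimes> restrict_dot \<pi> J)"

definition ncp_counit :: "'k::field_char_0 ncp_alg \<Rightarrow> 'k" where
  "ncp_counit = subst (*) (\<lambda>_. 0)"

definition Phi_FdB :: "'k::field_char_0 H_FdB \<Rightarrow> 'k ncp_alg" where
  "Phi_FdB = subst scale (\<lambda>v. gen (J_ncp (Rep_pos v)))"

end

theory Submission
  imports Defs
begin

text \<open>
  A morphism of commutative algebras out of \<open>H_FdB\<close> is determined by its values on the \<open>x\<^sub>n\<close>, so
  compatibility with coproducts and counits need only be checked there, once the coproduct of
  \<open>x\<^sub>n\<close> is known explicitly. Put \<open>x\<^sub>0 = 1\<close>. Expanding \<open>f \<circ> g = \<Sum>\<^sub>k f\<^bsub>k+1\<^esub> g\<^bsup>k+1\<^esup>\<close>, the coefficient of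
  \<open>x\<^bsup>n+1\<^esup>\<close> in \<open>g\<^bsup>k+1\<^esup>\<close> is a sum over weak compositions of \<open>n - k\<close> into \<open>k + 1\<close> parts. Such a
  composition is the same as a subset \<open>A\<close> of \<open>{1..n}\<close> with \<open>n - k\<close> elements: its nonzero parts are
  the lengths of the maximal intervals of \<open>A\<close>, and the \<open>k\<close> missing points separate the parts
  (\<open>fps_power_nth_eq_sum_run_product\<close>). Therefore
  \<open>\<Delta> x\<^sub>n = \<Sum>\<^bsub>A \<subseteq> {1..n}\<^esub> x\<^bsub>n-|A|\<^esub> \<otimes> \<Prod>\<^bsub>I run of A\<^esub> x\<^bsub>|I|\<^esub>\<close>.
  On the other side, distinct blocks of \<open>J\<^sub>n\<close> are incomparable in the nesting order, so every set
  of blocks is an ideal; restrictions of \<open>J\<^sub>n\<close> are again partitions into singletons, and its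
  coproduct is literally the same sum with \<open>J\<close> in place of \<open>x\<close> (\<open>ncp_coproduct_J_ncp\<close>).

  That this formula is the coproduct of \<open>H_FdB\<close>, which is characterised by its values as a function
  on pairs of series, requires such functions to determine elements of the tensor square
  (\<open>fdb_eval2_inject\<close>). The basis elements of the tensor square give distinct
  multiplicative characters, which are linearly independent by Dedekind's lemma.

  For the antipodes, \<open>\<Delta> m\<close> is \<open>m \<otimes> 1\<close> plus terms whose left factor has smaller degree, for every
  monomial \<open>m\<close> (\<open>fdb_coproduct_triangular\<close>). The defining identity of an antipode then is a
  recursion on the degree which \<open>\<Phi> \<circ> S\<close> and \<open>S' \<circ> \<Phi>\<close> both satisfy
  (\<open>bialgebra_hom_commutes_with_antipode\<close>).
\<close>

section \<open>Linear maps out of a monoid algebra\<close>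

abbreviation monomial :: "'m::comm_monoid_add \<Rightarrow> ('m \<Rightarrow>\<^sub>0 'k::comm_ring_1)" where
  "monomial m \<equiv> Poly_Mapping.single m 1"

lemma vector_space_scale: "vector_space (scale :: 'k::field \<Rightarrow> ('m::comm_monoid_add \<Rightarrow>\<^sub>0 'k) \<Rightarrow> _)"
  by unfold_locales (auto simp: scale_def algebra_simps single_add mult_single single_one
      simp flip: mult.assoc)

text \<open>Scalar multiplications for which the target of \<^const>\<open>subst\<close> is a commutative algebra;
  the instances are \<^const>\<open>scale\<close> and the multiplication of the ground field.\<close>

locale comm_algebra = vector_space s
  for s :: "'k::field \<Rightarrow> 'a::comm_ring_1 \<Rightarrow> 'a" +
  assumes scale_mult_left: "s c (a * b) = s c a * b"
begin

lemma scale_mult_right: "s c (a * b) = a * s c b"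
  using scale_mult_left[of c b a] by (simp add: mult.commute)

lemma linear_mult: "Vector_Spaces.linear s s (\<lambda>a. a * b)" "Vector_Spaces.linear s s (\<lambda>a. b * a)"
  using vector_space_axioms
  by (auto simp: Vector_Spaces.linear_iff algebra_simps scale_mult_left scale_mult_right)

end

lemma comm_algebra_scale:
  "comm_algebra (scale :: 'k::field \<Rightarrow> ('m::comm_monoid_add \<Rightarrow>\<^sub>0 'k) \<Rightarrow> _)"
  by (intro comm_algebra.intro vector_space_scale comm_algebra_axioms.intro)
    (simp add: scale_def mult.assoc)

lemma comm_algebra_mult: "comm_algebra ((*) :: 'k::field \<Rightarrow> 'k \<Rightarrow> 'k)"
  by unfold_locales (auto simp: algebra_simps)

text \<open>The functions \<^const>\<open>subst\<close>, \<^const>\<open>lin_ext\<close> and \<^const>\<open>fdb_eval2\<close> are all linear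
  extensions of a function on the basis; this is their common form.\<close>

definition extend_linear :: "('k::comm_ring_1 \<Rightarrow> 'a::comm_monoid_add \<Rightarrow> 'a) \<Rightarrow> ('m \<Rightarrow> 'a) \<Rightarrow> ('m \<Rightarrow>\<^sub>0 'k) \<Rightarrow> 'a"
  where "extend_linear s h p = (\<Sum>m\<in>Poly_Mapping.keys p. s (Poly_Mapping.lookup p m) (h m))"

lemma lin_ext_eq_extend_linear: "lin_ext h = extend_linear scale h"
  by (simp add: fun_eq_iff lin_ext_def extend_linear_def)

lemma extend_linear_superset:
  assumes "vector_space s" "finite A" "Poly_Mapping.keys p \<subseteq> A"
  shows "extend_linear s h p = (\<Sum>m\<in>A. s (Poly_Mapping.lookup p m) (h m))"
proof -
  interpret vector_space s by fact
  show ?thesis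
    unfolding extend_linear_def using assms(2,3)
    by (intro sum.mono_neutral_left) (auto simp: in_keys_iff)
qed

lemma linear_extend_linear:
  assumes "vector_space s"
  shows "Vector_Spaces.linear scale s (extend_linear s h)"
proof -
  interpret vector_space s by fact
  have "extend_linear s h (p + q) = extend_linear s h p + extend_linear s h q" for p q
  proof -
    let ?A = "Poly_Mapping.keys p \<union> Poly_Mapping.keys q"
    have "extend_linear s h (p + q) = (\<Sum>m\<in>?A. s (Poly_Mapping.lookup (p + q) m) (h m))"
      by (intro extend_linear_superset assms finite_UnI finite_keys keys_add)
    also have "\<dots> = (\<Sum>m\<in>?A. s (Poly_Mapping.lookup p m) (h m)) + (\<Sum>m\<in>?A. s (Poly_Mapping.lookup q m) (h m))"
      by (simp add: lookup_add scale_left_distrib sum.distrib)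
    also have "\<dots> = extend_linear s h p + extend_linear s h q"
      by (simp add: extend_linear_superset[OF assms, of ?A])
    finally show ?thesis .
  qed
  moreover have "extend_linear s h (scale c p) = s c (extend_linear s h p)" for c p
  proof -
    have "extend_linear s h (scale c p) =
        (\<Sum>m\<in>Poly_Mapping.keys p. s (Poly_Mapping.lookup (scale c p) m) (h m))"
      by (intro extend_linear_superset assms) (auto simp: in_keys_iff lookup_scale)
    also have "\<dots> = s c (extend_linear s h p)"
      by (simp add: lookup_scale extend_linear_def scale_sum_right)
    finally show ?thesis .
  qed
  ultimately show ?thesis
    using assms vector_space_scale by (simp add: Vector_Spaces.linear_iff)
qed

lemma linear_lin_ext:
  "Vector_Spaces.linear scale scale (lin_ext (h :: 'm::comm_monoid_add \<Rightarrow> ('n::comm_monoid_add \<Rightarrow>\<^sub>0 'k::field)))"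
  unfolding lin_ext_eq_extend_linear by (rule linear_extend_linear[OF vector_space_scale])

lemma extend_linear_single:
  assumes "vector_space s"
  shows "extend_linear s h (Poly_Mapping.single m c) = s c (h m)"
proof -
  interpret vector_space s by fact
  show ?thesis by (simp add: extend_linear_def)
qed

lemma lin_ext_single: "lin_ext h (Poly_Mapping.single m (c :: 'k::field)) = scale c (h m)"
  unfolding lin_ext_eq_extend_linear by (rule extend_linear_single[OF vector_space_scale])

lemma scale_one [simp]: "scale 1 p = p"
  by (simp add: scale_def single_one)

text \<open>Two principles that turn most identities below into a check on basis elements.\<close>

lemma linear_eqI:
  assumes "Vector_Spaces.linear scale s F" "Vector_Spaces.linear scale s G"
    and basis: "\<And>m. F (monomial m) = G (monomial m)"
  shows "F p = G p"
proof -
  interpret F: Vector_Spaces.linear scale s F by fact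
  interpret G: Vector_Spaces.linear scale s G by fact
  have "p = (\<Sum>m\<in>Poly_Mapping.keys p. scale (Poly_Mapping.lookup p m) (monomial m))"
    by (rule poly_mapping_eqI) (simp add: lookup_sum lookup_scale lookup_single when_def in_keys_iff if_distrib cong: if_cong)
  then show ?thesis
    by (metis (no_types, lifting) F.sum F.scale G.sum G.scale basis sum.cong)
qed

lemma bilinear_eqI:
  assumes "\<And>q. Vector_Spaces.linear scale s (\<lambda>p. F p q)" "\<And>q. Vector_Spaces.linear scale s (\<lambda>p. G p q)"
    and "\<And>p. Vector_Spaces.linear scale s (F p)" "\<And>p. Vector_Spaces.linear scale s (G p)"
    and "\<And>m n. F (monomial m) (monomial n) = G (monomial m) (monomial n)"
  shows "F p q = G p q"
  by (rule linear_eqI[OF assms(1,2)], rule linear_eqI[OF assms(3,4)], rule assms(5))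

lemma extend_linear_mult:
  fixes h :: "'m::comm_monoid_add \<Rightarrow> 'a::comm_ring_1"
  assumes s: "comm_algebra s" and h: "\<And>m n. h (m + n) = h m * h n"
  shows "extend_linear s h (p * q) = extend_linear s h p * extend_linear s h q"
proof -
  interpret comm_algebra s by fact
  interpret S: comm_algebra scale by (rule comm_algebra_scale)
  note lin = linear_extend_linear[OF vector_space_axioms, of h]
  note comp = Vector_Spaces.linear_compose[unfolded o_def]
  show ?thesis
    by (rule bilinear_eqI)
      (auto intro!: comp[OF S.linear_mult(1) lin] comp[OF S.linear_mult(2) lin]
        comp[OF lin linear_mult(1)] comp[OF lin linear_mult(2)]
        simp: mult_single extend_linear_single[OF vector_space_axioms] h)
qed


section \<open>Algebra morphisms out of a polynomial algebra\<close>

definition monom_value :: "('v \<Rightarrow> 'a::comm_monoid_mult) \<Rightarrow> ('v \<Rightarrow>\<^sub>0 nat) \<Rightarrow> 'a" where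
  "monom_value h m = (\<Prod>v\<in>Poly_Mapping.keys m. h v ^ Poly_Mapping.lookup m v)"

lemma monom_value_superset:
  "finite A \<Longrightarrow> Poly_Mapping.keys m \<subseteq> A \<Longrightarrow> monom_value h m = (\<Prod>v\<in>A. h v ^ Poly_Mapping.lookup m v)"
  unfolding monom_value_def by (rule prod.mono_neutral_left) (auto simp: in_keys_iff)

lemma monom_value_0 [simp]: "monom_value h 0 = 1"
  by (simp add: monom_value_def)

lemma monom_value_single [simp]: "monom_value h (Poly_Mapping.single v n) = h v ^ n"
  by (subst monom_value_superset[of "{v}"]) auto

lemma monom_value_add: "monom_value h (m + n) = monom_value h m * monom_value h n"
proof -
  let ?A = "Poly_Mapping.keys m \<union> Poly_Mapping.keys n"
  have "monom_value h (m + n) = (\<Prod>v\<in>?A. h v ^ Poly_Mapping.lookup (m + n) v)"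
    by (intro monom_value_superset finite_UnI finite_keys keys_add)
  also have "\<dots> = (\<Prod>v\<in>?A. h v ^ Poly_Mapping.lookup m v) * (\<Prod>v\<in>?A. h v ^ Poly_Mapping.lookup n v)"
    by (simp add: lookup_add power_add prod.distrib)
  also have "\<dots> = monom_value h m * monom_value h n"
    by (simp add: monom_value_superset[of ?A])
  finally show ?thesis .
qed

lemma monom_induct [case_names zero var add]:
  fixes m :: "'v \<Rightarrow>\<^sub>0 nat"
  assumes zero: "P 0" and var: "\<And>v. P (Poly_Mapping.single v 1)"
    and add: "\<And>m n. P m \<Longrightarrow> P n \<Longrightarrow> P (m + n)"
  shows "P m"
proof -
  have pow: "P (Poly_Mapping.single v k)" for v k
  proof (induction k)
    case (Suc k)
    then show ?case
      using add[OF var[of v] Suc.IH] by (simp flip: single_add)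
  qed (simp add: zero)
  have "P (\<Sum>v\<in>A. Poly_Mapping.single v (Poly_Mapping.lookup m v))" if "finite A" for A
    using that by induction (auto intro: zero add pow)
  moreover have "m = (\<Sum>v\<in>Poly_Mapping.keys m. Poly_Mapping.single v (Poly_Mapping.lookup m v))"
    by (rule poly_mapping_eqI) (simp add: lookup_sum lookup_single when_def in_keys_iff)
  ultimately show ?thesis by (metis finite_keys)
qed

lemma subst_eq_extend_linear: "subst s h = extend_linear s (monom_value h)"
  by (simp add: fun_eq_iff subst_def extend_linear_def monom_value_def)

lemma subst_monomial: "comm_algebra s \<Longrightarrow> subst s h (monomial m) = monom_value h m"
  unfolding subst_eq_extend_linear
  by (simp add: extend_linear_single comm_algebra_def vector_space.vector_space_assms(4))

lemma subst_gen: "comm_algebra s \<Longrightarrow> subst s h (gen v) = h v"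
  by (simp add: gen_def subst_monomial)

lemma algebra_hom_subst:
  assumes "comm_algebra s"
  shows "algebra_hom scale s (subst s h)"
  unfolding algebra_hom_def
  using linear_extend_linear[of s "monom_value h"] extend_linear_mult[OF assms, of "monom_value h"]
    subst_monomial[OF assms, of h 0] assms
  by (simp add: subst_eq_extend_linear monom_value_add single_one comm_algebra_def)

lemma algebra_hom_linear: "algebra_hom s t F \<Longrightarrow> Vector_Spaces.linear s t F"
  and algebra_hom_one: "algebra_hom s t F \<Longrightarrow> F 1 = 1"
  and algebra_hom_mult: "algebra_hom s t F \<Longrightarrow> F (p * q) = F p * F q"
  by (auto simp: algebra_hom_def)

lemma algebra_hom_prod: "algebra_hom s t F \<Longrightarrow> F (\<Prod>i\<in>A. h i) = (\<Prod>i\<in>A. F (h i))"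
  by (induction A rule: infinite_finite_induct) (auto simp: algebra_hom_one algebra_hom_mult)

lemma algebra_hom_compose:
  "algebra_hom s t F \<Longrightarrow> algebra_hom t u G \<Longrightarrow> algebra_hom s u (\<lambda>p. G (F p))"
  unfolding algebra_hom_def using Vector_Spaces.linear_compose[of s t F u G] by (simp add: o_def)

lemma algebra_hom_eqI:
  fixes F G :: "('v, 'k::field) free_calg \<Rightarrow> 'a::comm_ring_1"
  assumes F: "algebra_hom scale s F" and G: "algebra_hom scale s G"
    and gen: "\<And>v. F (gen v) = G (gen v)"
  shows "F p = G p"
proof (rule linear_eqI[OF algebra_hom_linear[OF F] algebra_hom_linear[OF G]])
  show "F (monomial m) = G (monomial m)" for m
  proof (induction m rule: monom_induct)
    case zero
    then show ?case by (simp add: single_one algebra_hom_one[OF F] algebra_hom_one[OF G])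
  next
    case (var v)
    then show ?case using gen[of v] by (simp add: gen_def)
  next
    case (add m n)
    have "monomial (m + n) = monomial m * (monomial n :: ('v, 'k) free_calg)"
      by (simp add: mult_single)
    with add show ?case by (simp add: algebra_hom_mult[OF F] algebra_hom_mult[OF G])
  qed
qed


section \<open>Tensor products\<close>

lemma linear_tensor_left:
  fixes q :: "'n::comm_monoid_add \<Rightarrow>\<^sub>0 'k::field"
  shows "Vector_Spaces.linear scale scale (\<lambda>p :: 'm::comm_monoid_add \<Rightarrow>\<^sub>0 'k. p \<otimes> q)"
  unfolding Vector_Spaces.linear_iff
  by (auto intro!: vector_space_scale poly_mapping_eqI
      simp: lookup_tensor lookup_add lookup_scale algebra_simps)

lemma linear_tensor_right:
  fixes p :: "'m::comm_monoid_add \<Rightarrow>\<^sub>0 'k::field"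
  shows "Vector_Spaces.linear scale scale (\<lambda>q :: 'n::comm_monoid_add \<Rightarrow>\<^sub>0 'k. p \<otimes> q)"
  unfolding Vector_Spaces.linear_iff
  by (auto intro!: vector_space_scale poly_mapping_eqI
      simp: lookup_tensor lookup_add lookup_scale algebra_simps)

lemma tensor_monomial [simp]: "monomial m \<otimes> monomial n = monomial (m, n)"
  by (rule poly_mapping_eqI, rename_tac k, case_tac k)
    (auto simp: lookup_tensor lookup_single when_def)

text \<open>The tensor product is the product of the images of its factors under the two inclusions,
  and these are algebra morphisms.\<close>

lemma tensor_mult:
  fixes p p' :: "'m::comm_monoid_add \<Rightarrow>\<^sub>0 'k::field" and q q' :: "'n::comm_monoid_add \<Rightarrow>\<^sub>0 'k"
  shows "(p \<otimes> q) * (p' \<otimes> q') = (p * p') \<otimes> (q * q')"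
proof -
  define L :: "('m \<Rightarrow>\<^sub>0 'k) \<Rightarrow> ('m \<times> 'n \<Rightarrow>\<^sub>0 'k)" where "L = lin_ext (\<lambda>m. monomial (m, 0))"
  define R :: "('n \<Rightarrow>\<^sub>0 'k) \<Rightarrow> ('m \<times> 'n \<Rightarrow>\<^sub>0 'k)" where "R = lin_ext (\<lambda>n. monomial (0, n))"
  have tensor: "p \<otimes> q = L p * R q" for p q
  proof (rule bilinear_eqI[where F = "(\<otimes>)" and G = "\<lambda>p q. L p * R q"])
    show "monomial m \<otimes> monomial n = L (monomial m) * R (monomial n)" for m n
      by (simp add: L_def R_def lin_ext_single mult_single)
    show "Vector_Spaces.linear scale scale (\<lambda>p. L p * R q)" for q
      unfolding L_def
      by (rule Vector_Spaces.linear_compose[OF linear_lin_ext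
            comm_algebra.linear_mult(1)[OF comm_algebra_scale], unfolded o_def])
    show "Vector_Spaces.linear scale scale (\<lambda>q. L p * R q)" for p
      unfolding R_def
      by (rule Vector_Spaces.linear_compose[OF linear_lin_ext
            comm_algebra.linear_mult(2)[OF comm_algebra_scale], unfolded o_def])
  qed (rule linear_tensor_left linear_tensor_right)+
  have "L (p * p') = L p * L p'"
    unfolding L_def lin_ext_eq_extend_linear
    by (rule extend_linear_mult[OF comm_algebra_scale]) (simp add: mult_single)
  moreover have "R (q * q') = R q * R q'"
    unfolding R_def lin_ext_eq_extend_linear
    by (rule extend_linear_mult[OF comm_algebra_scale]) (simp add: mult_single)
  ultimately show ?thesis by (simp add: tensor mult_ac)
qed

lemma tensor_one [simp]: "1 \<otimes> 1 = 1"
  using tensor_monomial[of 0 0] by (simp add: single_one flip: zero_prod_def)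

text \<open>The form in which \<^const>\<open>tensor_map\<close> and \<^const>\<open>mult_map\<close>
  are evaluated on pure tensors.\<close>

lemma lin_ext_tensor:
  fixes p :: "'m::comm_monoid_add \<Rightarrow>\<^sub>0 'k::field" and q :: "'n::comm_monoid_add \<Rightarrow>\<^sub>0 'k"
    and B :: "_ \<Rightarrow> _ \<Rightarrow> ('l::comm_monoid_add \<Rightarrow>\<^sub>0 'k)"
  assumes "\<And>q. Vector_Spaces.linear scale scale (\<lambda>p. B p q)" "\<And>p. Vector_Spaces.linear scale scale (B p)"
  shows "lin_ext (\<lambda>(m, n). B (monomial m) (monomial n)) (p \<otimes> q) = B p q"
  by (rule bilinear_eqI)
    (auto intro!: assms Vector_Spaces.linear_compose[OF linear_tensor_left linear_lin_ext, unfolded o_def]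
      Vector_Spaces.linear_compose[OF linear_tensor_right linear_lin_ext, unfolded o_def]
      simp: lin_ext_single)

lemma tensor_map_tensor:
  fixes p :: "'m::comm_monoid_add \<Rightarrow>\<^sub>0 'k::field" and q :: "'n::comm_monoid_add \<Rightarrow>\<^sub>0 'k"
  assumes "Vector_Spaces.linear scale scale F" "Vector_Spaces.linear scale scale G"
  shows "tensor_map F G (p \<otimes> q) = F p \<otimes> G q"
  unfolding tensor_map_def
  by (rule lin_ext_tensor[where B = "\<lambda>p q. F p \<otimes> G q"])
    (auto intro!: Vector_Spaces.linear_compose[OF assms(1) linear_tensor_left, unfolded o_def]
      Vector_Spaces.linear_compose[OF assms(2) linear_tensor_right, unfolded o_def])

lemma linear_tensor_map:
  "Vector_Spaces.linear scale scale (tensor_map F (G :: ('n::comm_monoid_add \<Rightarrow>\<^sub>0 'k::field) \<Rightarrow> _))"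
  unfolding tensor_map_def by (rule linear_lin_ext)

lemma mult_map_tensor: "mult_map (p \<otimes> q) = (p * q :: _ \<Rightarrow>\<^sub>0 'k::field)"
  unfolding mult_map_def
  by (rule lin_ext_tensor) (rule comm_algebra.linear_mult[OF comm_algebra_scale])+

lemma linear_mult_map: "Vector_Spaces.linear scale scale (mult_map :: _ \<Rightarrow> (_ \<Rightarrow>\<^sub>0 'k::field))"
  unfolding mult_map_def by (rule linear_lin_ext)

lemma algebra_hom_tensor_map:
  fixes F G :: "(_ \<Rightarrow>\<^sub>0 'k::field) \<Rightarrow> _"
  assumes F: "algebra_hom scale scale F" and G: "algebra_hom scale scale G"
  shows "algebra_hom scale scale (tensor_map F G)"
proof -
  note linear = algebra_hom_linear[OF F] algebra_hom_linear[OF G]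
  have one: "tensor_map F G 1 = 1"
    using tensor_map_tensor[OF linear, of 1 1] by (simp add: algebra_hom_one[OF F] algebra_hom_one[OF G])
  have monomial_mult: "tensor_map F G (monomial (a + b)) = tensor_map F G (monomial a) * tensor_map F G (monomial b)" for a b
  proof (cases a; cases b)
    fix a1 a2 b1 b2 assume [simp]: "a = (a1, a2)" "b = (b1, b2)"
    have "tensor_map F G (monomial (a + b)) =
        tensor_map F G ((monomial a1 * monomial b1) \<otimes> (monomial a2 * monomial b2))"
      by (simp add: mult_single)
    also have "\<dots> = (F (monomial a1) * F (monomial b1)) \<otimes> (G (monomial a2) * G (monomial b2))"
      by (simp add: tensor_map_tensor[OF linear] algebra_hom_mult[OF F] algebra_hom_mult[OF G] del: mult_single)
    also have "\<dots> = tensor_map F G (monomial a) * tensor_map F G (monomial b)"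
      using tensor_map_tensor[OF linear, of "monomial a1" "monomial a2"]
        tensor_map_tensor[OF linear, of "monomial b1" "monomial b2"]
      by (simp add: tensor_mult)
    finally show ?thesis .
  qed
  have "tensor_map F G (p * q) = tensor_map F G p * tensor_map F G q" for p q
  proof -
    define h where "h = (\<lambda>(m, n). F (monomial m) \<otimes> G (monomial n))"
    have "tensor_map F G (monomial a) = h a" for a
      by (simp add: tensor_map_def h_def lin_ext_single)
    with monomial_mult have "h (a + b) = h a * h b" for a b by metis
    then show ?thesis
      using extend_linear_mult[OF comm_algebra_scale, of h p q]
      by (simp add: tensor_map_def lin_ext_eq_extend_linear h_def)
  qed
  with one show ?thesis
    by (simp add: algebra_hom_def linear_tensor_map)
qed


section \<open>Morphisms and antipodes\<close>

text \<open>
  The condition \<open>m (S \<otimes> id) (\<Delta> m) = \<epsilon> m\<close> reads \<open>S m + (terms in S a with wt a < wt m) = \<epsilon> m\<close>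
  when \<open>\<Delta> m = m \<otimes> 1\<close> up to terms whose left factor has smaller weight. So it determines \<open>S\<close>
  recursively, and \<open>F \<circ> S\<close> and \<open>S' \<circ> F\<close> satisfy the same recursion.
\<close>

lemma bialgebra_hom_commutes_with_antipode:
  fixes F :: "('m::comm_monoid_add \<Rightarrow>\<^sub>0 'k::field) \<Rightarrow> ('n::comm_monoid_add \<Rightarrow>\<^sub>0 'k)" and wt :: "'m \<Rightarrow> nat"
  assumes F: "algebra_hom scale scale F"
    and \<Delta>: "\<And>p. \<Delta>' (F p) = tensor_map F F (\<Delta> p)"
    and \<epsilon>: "\<And>p. \<epsilon>' (F p) = \<epsilon> p"
    and triangular: "\<And>m a b. (a, b) \<in> Poly_Mapping.keys (\<Delta> (monomial m) - monomial (m, 0)) \<Longrightarrow> wt a < wt m"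
    and S: "is_antipode \<Delta> \<epsilon> S" and S': "is_antipode \<Delta>' \<epsilon>' S'"
  shows "F (S p) = S' (F p)"
proof -
  note linear_F = algebra_hom_linear[OF F]
  have linear_S: "Vector_Spaces.linear scale scale S" and linear_S': "Vector_Spaces.linear scale scale S'"
    using S S' by (auto simp: is_antipode_def)
  have linear_id: "Vector_Spaces.linear scale scale (id :: ('l::comm_monoid_add \<Rightarrow>\<^sub>0 'k) \<Rightarrow> _)"
    using vector_space_scale by (simp add: Vector_Spaces.linear_iff)
  note comp = Vector_Spaces.linear_compose[unfolded o_def]
  have linear_FS: "Vector_Spaces.linear scale scale (\<lambda>p. F (S p))"
    and linear_S'F: "Vector_Spaces.linear scale scale (\<lambda>p. S' (F p))"
    by (rule comp[OF linear_S linear_F], rule comp[OF linear_F linear_S'])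
  define E :: "(('m \<Rightarrow>\<^sub>0 'k) \<Rightarrow> ('n \<Rightarrow>\<^sub>0 'k)) \<Rightarrow> ('m \<times> 'm \<Rightarrow>\<^sub>0 'k) \<Rightarrow> ('n \<Rightarrow>\<^sub>0 'k)" where "E T = lin_ext (\<lambda>(a, b). T (monomial a) * F (monomial b))" for T
  have FS: "F (mult_map (tensor_map S id t)) = E (\<lambda>p. F (S p)) t" for t
  proof (rule linear_eqI[where F = "\<lambda>t. F (mult_map (tensor_map S id t))"])
    show "Vector_Spaces.linear scale scale (\<lambda>t. F (mult_map (tensor_map S id t)))"
      by (rule comp[OF comp[OF linear_tensor_map linear_mult_map] linear_F])
    show "Vector_Spaces.linear scale scale (E (\<lambda>p. F (S p)))"
      unfolding E_def by (rule linear_lin_ext)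
    fix k :: "'m \<times> 'm"
    obtain a b where k: "k = (a, b)" by (cases k)
    show "F (mult_map (tensor_map S id (monomial k))) = E (\<lambda>p. F (S p)) (monomial k)"
      using tensor_map_tensor[OF linear_S linear_id, of "monomial a" "monomial b"]
      by (simp add: k E_def lin_ext_single mult_map_tensor algebra_hom_mult[OF F])
  qed
  have S'F: "mult_map (tensor_map S' id (tensor_map F F t)) = E (\<lambda>p. S' (F p)) t" for t
  proof (rule linear_eqI[where F = "\<lambda>t. mult_map (tensor_map S' id (tensor_map F F t))"])
    show "Vector_Spaces.linear scale scale (\<lambda>t. mult_map (tensor_map S' id (tensor_map F F t)))"
      by (rule comp[OF comp[OF linear_tensor_map linear_tensor_map] linear_mult_map])
    show "Vector_Spaces.linear scale scale (E (\<lambda>p. S' (F p)))"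
      unfolding E_def by (rule linear_lin_ext)
    fix k :: "'m \<times> 'm"
    obtain a b where k: "k = (a, b)" by (cases k)
    show "mult_map (tensor_map S' id (tensor_map F F (monomial k))) = E (\<lambda>p. S' (F p)) (monomial k)"
      using tensor_map_tensor[OF linear_F linear_F, of "monomial a" "monomial b"]
      by (simp add: k E_def lin_ext_single mult_map_tensor tensor_map_tensor[OF linear_S' linear_id])
  qed
  have F_const: "F (Poly_Mapping.single 0 c) = Poly_Mapping.single 0 c" for c
  proof -
    interpret F: Vector_Spaces.linear scale scale F by (rule linear_F)
    show ?thesis
      using F.scale[of c 1] algebra_hom_one[OF F] by (simp add: scale_def)
  qed
  have same: "E (\<lambda>p. F (S p)) (\<Delta> q) = E (\<lambda>p. S' (F p)) (\<Delta> q)" for q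
  proof -
    have "E (\<lambda>p. F (S p)) (\<Delta> q) = Poly_Mapping.single 0 (\<epsilon> q)"
      using S by (simp add: FS[symmetric] is_antipode_def F_const)
    moreover have "E (\<lambda>p. S' (F p)) (\<Delta> q) = Poly_Mapping.single 0 (\<epsilon> q)"
      using S' by (simp add: S'F[symmetric] \<Delta>[symmetric] is_antipode_def \<epsilon>)
    ultimately show ?thesis by simp
  qed
  have "F (S (monomial m)) = S' (F (monomial m))" for m
  proof (induction m rule: measure_induct_rule[of wt])
    case (less m)
    define l where "l = \<Delta> (monomial m) - monomial (m, 0)"
    have split: "E T (\<Delta> (monomial m)) = T (monomial m) + E T l" for T
    proof -
      interpret E: Vector_Spaces.linear scale scale "E T"
        unfolding E_def by (rule linear_lin_ext)
      show ?thesis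
        by (simp add: l_def E.diff)
          (simp add: E_def lin_ext_single single_one algebra_hom_one[OF F])
    qed
    have "E (\<lambda>p. F (S p)) l = E (\<lambda>p. S' (F p)) l"
      unfolding E_def lin_ext_def
      by (intro sum.cong refl) (auto simp: l_def dest!: triangular less)
    with same[of "monomial m"] show ?case by (simp add: split)
  qed
  then show ?thesis by (rule linear_eqI[OF linear_FS linear_S'F])
qed


section \<open>Polynomials as functions\<close>

text \<open>Dedekind's independence of characters, for characters of any set with a binary operation.
  Combining the relation at \<open>x \<star> y\<close> with \<open>\<chi> j y\<close> times the relation at \<open>x\<close> eliminates \<open>\<chi> j\<close>.\<close>

lemma characters_independent:
  fixes \<chi> :: "'i \<Rightarrow> 'x \<Rightarrow> 'k::field" and c :: "'i \<Rightarrow> 'k" and star :: "'x \<Rightarrow> 'x \<Rightarrow> 'x" (infixl \<open>\<star>\<close> 70)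
  assumes "finite I"
    and "\<And>i x y. i \<in> I \<Longrightarrow> \<chi> i (x \<star> y) = \<chi> i x * \<chi> i y"
    and "\<And>i. i \<in> I \<Longrightarrow> \<exists>x. \<chi> i x \<noteq> 0"
    and "inj_on \<chi> I"
    and "\<And>x. (\<Sum>i\<in>I. c i * \<chi> i x) = 0"
  shows "\<forall>i\<in>I. c i = 0"
  using assms
proof (induction I arbitrary: c rule: finite_induct)
  case (insert j I)
  have rel: "c j * \<chi> j x + (\<Sum>i\<in>I. c i * \<chi> i x) = 0" for x
    using insert.prems(4)[of x] insert.hyps by simp
  have "\<forall>i\<in>I. c i * (\<chi> i y - \<chi> j y) = 0" for y
  proof (rule insert.IH)
    show "(\<Sum>i\<in>I. c i * (\<chi> i y - \<chi> j y) * \<chi> i x) = 0" for x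
    proof -
      have "(\<Sum>i\<in>I. c i * (\<chi> i y - \<chi> j y) * \<chi> i x) =
          (\<Sum>i\<in>I. c i * \<chi> i (x \<star> y)) - \<chi> j y * (\<Sum>i\<in>I. c i * \<chi> i x)"
        using insert.prems(1) by (simp add: sum_subtractf sum_distrib_left algebra_simps)
      also have "\<dots> = 0"
      proof -
        have "(\<Sum>i\<in>I. c i * \<chi> i (x \<star> y)) = - (c j * (\<chi> j x * \<chi> j y))"
          using rel[of "x \<star> y"] insert.prems(1)[of j x y] by (simp add: eq_neg_iff_add_eq_0 add.commute)
        moreover have "(\<Sum>i\<in>I. c i * \<chi> i x) = - (c j * \<chi> j x)"
          using rel[of x] by (simp add: eq_neg_iff_add_eq_0 add.commute)
        ultimately show ?thesis by simp
      qed
      finally show ?thesis .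
    qed
  qed (use insert.prems in \<open>auto intro: inj_on_subset\<close>)
  moreover have "\<exists>y. \<chi> i y \<noteq> \<chi> j y" if "i \<in> I" for i
  proof -
    have "\<chi> i \<noteq> \<chi> j"
      using that insert.hyps(2) inj_onD[OF insert.prems(3), of i j] by blast
    then show ?thesis by (simp add: fun_eq_iff)
  qed
  ultimately have "\<forall>i\<in>I. c i = 0"
    by (metis eq_iff_diff_eq_0 mult_eq_0_iff)
  moreover from this have "c j = 0"
    using rel insert.prems(2)[of j] by auto
  ultimately show ?case by simp
qed simp

lemma monom_value_mult:
  "monom_value (\<lambda>v. a v * b v) m = monom_value a m * (monom_value b m :: 'a::comm_monoid_mult)"
  by (simp add: monom_value_def power_mult_distrib prod.distrib)

lemma monom_value_one [simp]: "monom_value (\<lambda>v. 1) m = 1"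
  by (simp add: monom_value_def)

lemma inj_monom_value:
  fixes m m' :: "'v \<Rightarrow>\<^sub>0 nat"
  assumes "\<And>a :: 'v \<Rightarrow> 'k::field_char_0. monom_value a m = monom_value a m'"
  shows "m = m'"
proof (rule poly_mapping_eqI)
  fix v :: 'v
  \<comment> \<open>Evaluating at \<open>2\<close> in the variable \<open>v\<close> and \<open>1\<close> elsewhere reads off the exponent of \<open>v\<close>.\<close>
  have "monom_value (\<lambda>u. if u = v then 2 else 1 :: 'k) n = 2 ^ Poly_Mapping.lookup n v" for n
  proof -
    have "monom_value (\<lambda>u. if u = v then 2 else 1 :: 'k) n =
        (\<Prod>u\<in>insert v (Poly_Mapping.keys n). (if u = v then 2 else 1) ^ Poly_Mapping.lookup n u)"
      by (rule monom_value_superset) auto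
    also have "\<dots> = (\<Prod>u\<in>{v}. 2 ^ Poly_Mapping.lookup n u)"
      by (rule prod.mono_neutral_cong_right) auto
    finally show ?thesis by simp
  qed
  with assms have "(2::'k) ^ Poly_Mapping.lookup m v = 2 ^ Poly_Mapping.lookup m' v" by metis
  then have "(of_nat (2 ^ Poly_Mapping.lookup m v) :: 'k) = of_nat (2 ^ Poly_Mapping.lookup m' v)" by simp
  then show "Poly_Mapping.lookup m v = Poly_Mapping.lookup m' v"
    by (simp only: of_nat_eq_iff) simp
qed

lemma algebra_hom_fdb_eval: "algebra_hom scale (*) (\<lambda>p. fdb_eval p f)"
  unfolding fdb_eval_def by (rule algebra_hom_subst[OF comm_algebra_mult])

lemma fdb_eval_monomial: "fdb_eval (monomial m) f = monom_value (\<lambda>v. coord (Rep_pos v) f) m"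
  unfolding fdb_eval_def by (rule subst_monomial[OF comm_algebra_mult])

lemma fdb_eval2_eq_extend_linear:
  "fdb_eval2 t f g = extend_linear (*) (\<lambda>(m, n). fdb_eval (monomial m) f * fdb_eval (monomial n) g) t"
  by (simp add: fdb_eval2_def extend_linear_def case_prod_unfold)

lemma linear_fdb_eval2: "Vector_Spaces.linear scale (*) (\<lambda>t. fdb_eval2 t f g)"
  unfolding fdb_eval2_eq_extend_linear
  by (rule linear_extend_linear) (use comm_algebra_mult comm_algebra_def in blast)

lemma fdb_eval2_tensor: "fdb_eval2 (p \<otimes> q) f g = fdb_eval p f * fdb_eval q g"
proof (rule bilinear_eqI[where F = "\<lambda>p q. fdb_eval2 (p \<otimes> q) f g" and G = "\<lambda>p q. fdb_eval p f * fdb_eval q g"])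
  note comp = Vector_Spaces.linear_compose[unfolded o_def]
  note linear_eval = algebra_hom_linear[OF algebra_hom_fdb_eval]
  show "Vector_Spaces.linear scale (*) (\<lambda>p. fdb_eval2 (p \<otimes> q) f g)" for q
    by (rule comp[OF linear_tensor_left linear_fdb_eval2])
  show "Vector_Spaces.linear scale (*) (\<lambda>q. fdb_eval2 (p \<otimes> q) f g)" for p
    by (rule comp[OF linear_tensor_right linear_fdb_eval2])
  show "Vector_Spaces.linear scale (*) (\<lambda>p. fdb_eval p f * fdb_eval q g)" for q
    by (rule comp[OF linear_eval comm_algebra.linear_mult(1)[OF comm_algebra_mult]])
  show "Vector_Spaces.linear scale (*) (\<lambda>q. fdb_eval p f * fdb_eval q g)" for p
    by (rule comp[OF linear_eval comm_algebra.linear_mult(2)[OF comm_algebra_mult]])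
  show "fdb_eval2 (monomial m \<otimes> monomial n) f g = fdb_eval (monomial m) f * fdb_eval (monomial n) g" for m n
    unfolding tensor_monomial fdb_eval2_eq_extend_linear
    by (subst extend_linear_single) (use comm_algebra_mult comm_algebra_def in auto)
qed

text \<open>Every family of coordinates belongs to a group element, so that polynomial functions on the
  group may be tested at arbitrary points.\<close>

definition series_of :: "(pos \<Rightarrow> 'k) \<Rightarrow> 'k::field_char_0 fps" where
  "series_of a = Abs_fps (\<lambda>i. if i = 0 then 0 else if i = 1 then 1 else a (Abs_pos (i - 1)))"

lemma series_of_in_G_FdB: "series_of a \<in> G_FdB"
  by (simp add: series_of_def G_FdB_def)

lemma Rep_pos_ge_1: "Rep_pos v \<ge> 1"
  using Rep_pos[of v] by simp

lemma coord_series_of: "coord (Rep_pos v) (series_of a) = a v"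
  using Rep_pos_ge_1[of v] by (simp add: coord_def series_of_def Rep_pos_inverse)

text \<open>The identification of \<open>H_FdB \<otimes> H_FdB\<close> with functions on \<open>G_FdB \<times> G_FdB\<close> is injective: its
  basis elements are pairwise distinct characters.\<close>

lemma fdb_eval2_inject:
  fixes t t' :: "(pos \<Rightarrow>\<^sub>0 nat) \<times> (pos \<Rightarrow>\<^sub>0 nat) \<Rightarrow>\<^sub>0 'k::field_char_0"
  assumes eq: "\<And>f g. f \<in> G_FdB \<Longrightarrow> g \<in> G_FdB \<Longrightarrow> fdb_eval2 t f g = fdb_eval2 t' f g"
  shows "t = t'"
proof -
  define \<chi> :: "_ \<Rightarrow> (pos \<Rightarrow> 'k) \<times> (pos \<Rightarrow> 'k) \<Rightarrow> 'k"
    where "\<chi> = (\<lambda>(m, n) (a, b). monom_value a m * monom_value b n)"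
  let ?I = "Poly_Mapping.keys (t - t')"
  have "\<forall>i\<in>?I. Poly_Mapping.lookup (t - t') i = 0"
  proof (rule characters_independent[where \<chi> = \<chi>
        and star = "\<lambda>(a, b) (a', b'). (\<lambda>v. a v * a' v, \<lambda>v. b v * b' v)"])
    show "inj_on \<chi> ?I"
    proof (rule inj_onI, clarify)
      fix m n m' n' assume same: "\<chi> (m, n) = \<chi> (m', n')"
      have \<chi>: "monom_value a m * monom_value b n = monom_value a m' * monom_value b n'"
        for a b :: "pos \<Rightarrow> 'k"
        using fun_cong[OF same, of "(a, b)"] by (simp add: \<chi>_def)
      have "m = m'" by (rule inj_monom_value) (use \<chi>[of _ "\<lambda>v. 1"] in simp)
      moreover have "n = n'" by (rule inj_monom_value) (use \<chi>[of "\<lambda>v. 1"] in simp)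
      ultimately show "m = m' \<and> n = n'" by simp
    qed
    show "\<exists>x. \<chi> i x \<noteq> 0" for i
      by (rule exI[of _ "(\<lambda>v. 1, \<lambda>v. 1)"]) (simp add: \<chi>_def case_prod_unfold)
    show "(\<Sum>i\<in>?I. Poly_Mapping.lookup (t - t') i * \<chi> i x) = 0" for x
    proof -
      obtain a b where x: "x = (a, b)" by (cases x)
      interpret Vector_Spaces.linear scale "(*)" "\<lambda>t. fdb_eval2 t (series_of a) (series_of b)"
        by (rule linear_fdb_eval2)
      have "(\<Sum>i\<in>?I. Poly_Mapping.lookup (t - t') i * \<chi> i x) = fdb_eval2 (t - t') (series_of a) (series_of b)"
        by (simp add: fdb_eval2_def fdb_eval_monomial coord_series_of \<chi>_def x case_prod_unfold)
      also have "\<dots> = 0"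
        by (simp add: diff eq[OF series_of_in_G_FdB series_of_in_G_FdB])
      finally show ?thesis .
    qed
  qed (auto simp: \<chi>_def monom_value_mult)
  then have "Poly_Mapping.lookup (t - t') i = 0" for i
    by (metis in_keys_iff)
  then have "t - t' = 0" by (intro poly_mapping_eqI) simp
  then show ?thesis by simp
qed


section \<open>Runs and powers of a series\<close>

lemma finite_runs: "finite A \<Longrightarrow> finite (runs A)"
  by (rule finite_subset[of _ "Pow A"]) (auto simp: runs_def)

lemma runs_empty [simp]: "runs {} = {}"
  by (auto simp: runs_def consecutive_def)

lemma runs_interval: "a \<le> b \<Longrightarrow> runs {a..b} = {{a..b}}"
  by (auto simp: runs_def consecutive_def)

text \<open>A consecutive set avoiding the gap \<open>m\<close> lies on one side of it.\<close>

lemma runs_Un: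
  assumes A: "\<And>i. i \<in> A \<Longrightarrow> i < m" and B: "\<And>i. i \<in> B \<Longrightarrow> m < i"
  shows "runs (A \<union> B) = runs A \<union> runs B" and "runs A \<inter> runs B = {}"
proof -
  have nonempty: "I \<noteq> {}" if "consecutive I" for I
    using that by (auto simp: consecutive_def)
  have side: "I \<subseteq> A \<or> I \<subseteq> B" if I: "consecutive I" "I \<subseteq> A \<union> B" for I
  proof -
    obtain a b where ab: "a \<le> b" "I = {a..b}" using I(1) by (auto simp: consecutive_def)
    have "m \<notin> I" using I(2) A B by blast
    then consider "b < m" | "m < a" using ab by force
    then show ?thesis
    proof cases
      case 1
      then show ?thesis using ab I(2) B by (force dest: B)
    next
      case 2
      then show ?thesis using ab I(2) A by (force dest: A)
    qed
  qed
  have disjoint: "A \<inter> B = {}" using A B by (metis disjoint_iff less_asym)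
  have one_side: "runs C = {I \<in> runs (A \<union> B). I \<subseteq> C}" if C: "C = A \<or> C = B" for C
  proof -
    have "I' \<subseteq> C" if "consecutive I" "I \<subseteq> C" "consecutive I'" "I' \<subseteq> A \<union> B" "I \<subseteq> I'" for I I'
      using side[OF that(3,4)] nonempty[OF that(1)] that(2,5) C disjoint by blast
    note extends = this
    have "C \<subseteq> A \<union> B" using C by blast
    show ?thesis
    proof (intro set_eqI iffI)
      fix I assume "I \<in> runs C"
      then have I: "consecutive I" "I \<subseteq> C"
        and max: "\<And>I'. consecutive I' \<Longrightarrow> I' \<subseteq> C \<Longrightarrow> I \<subseteq> I' \<Longrightarrow> I' = I"
        by (auto simp: runs_def)
      have "I' = I" if "consecutive I'" "I' \<subseteq> A \<union> B" "I \<subseteq> I'" for I'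
        using that(1) extends[OF I that] that(3) by (rule max)
      with I \<open>C \<subseteq> A \<union> B\<close> show "I \<in> {I \<in> runs (A \<union> B). I \<subseteq> C}"
        by (auto simp: runs_def)
    next
      fix I assume "I \<in> {I \<in> runs (A \<union> B). I \<subseteq> C}"
      then have I: "consecutive I" "I \<subseteq> C"
        and max: "\<And>I'. consecutive I' \<Longrightarrow> I' \<subseteq> A \<union> B \<Longrightarrow> I \<subseteq> I' \<Longrightarrow> I' = I"
        by (auto simp: runs_def)
      have "I' = I" if "consecutive I'" "I' \<subseteq> C" "I \<subseteq> I'" for I'
        using that(1) subset_trans[OF that(2) \<open>C \<subseteq> A \<union> B\<close>] that(3) by (rule max)
      with I show "I \<in> runs C"
        by (simp add: runs_def)
    qed
  qed
  have "runs (A \<union> B) \<subseteq> runs A \<union> runs B"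
    using side one_side[of A] one_side[of B] by (auto simp: runs_def)
  then show "runs (A \<union> B) = runs A \<union> runs B"
    using one_side[of A] one_side[of B] by blast
  show "runs A \<inter> runs B = {}"
    using nonempty disjoint by (fastforce simp: runs_def)
qed

definition run_product :: "(nat \<Rightarrow> 'a::comm_monoid_mult) \<Rightarrow> nat set \<Rightarrow> 'a" where
  "run_product c A = (\<Prod>I\<in>runs A. c (card I))"

lemma run_product_after_gap:
  assumes "m \<le> n" "A \<subseteq> {1..<m}" "c 0 = 1"
  shows "run_product c (A \<union> {m+1..n}) = run_product c A * c (n - m)"
proof -
  have fin: "finite A" using assms(2) finite_subset by blast
  have "run_product c (A \<union> {m+1..n}) = run_product c A * run_product c {m+1..n}"
    unfolding run_product_def
    by (subst runs_Un[of A m], use assms(2) in force, force)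
      (rule prod.union_disjoint, use fin assms(2) in \<open>auto intro!: finite_runs runs_Un(2)[of A m]\<close>)
  also have "run_product c {m+1..n} = c (n - m)"
    using assms(1,3) by (cases "m = n") (auto simp: run_product_def runs_interval)
  finally show ?thesis .
qed

text \<open>
  Write \<open>g = x (1 + \<Sum>\<^sub>i b\<^sub>i x\<^sup>i)\<close>. A factor of \<open>g\<^bsup>k+1\<^esup>\<close> contributes some \<open>b\<^sub>i x\<^bsup>i+1\<^esup>\<close>, with \<open>b\<^sub>0 = 1\<close>.
  The coefficient of \<open>x\<^bsup>n+1\<^esup>\<close> is thus a sum over the weak compositions of \<open>n - k\<close> with \<open>k + 1\<close>
  parts, that is over the subsets of \<open>{1..n}\<close> with \<open>k\<close> missing elements: the parts are the lengths
  of the possibly empty intervals cut out by the missing elements, and the empty ones have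
  weight \<open>1\<close>. The induction splits off the last factor, that is the last interval.
\<close>

lemma fps_power_nth_eq_sum_run_product:
  fixes g :: "'k::field_char_0 fps"
  assumes g: "g \<in> G_FdB"
  shows "fps_nth (g ^ (k + 1)) (n + 1) =
    (\<Sum>A | A \<subseteq> {1..n} \<and> card A + k = n. run_product (\<lambda>i. coord i g) A)"
proof (induction k arbitrary: n)
  case 0
  have "{A. A \<subseteq> {1..n} \<and> card A + 0 = n} = {{1..n}}"
    using card_subset_eq[of "{1..n}"] by auto
  then show ?case
    using g run_product_after_gap[of 0 n "{}" "\<lambda>i. coord i g"]
    by (simp add: coord_def G_FdB_def) (simp add: run_product_def)
next
  case (Suc k)
  let ?w = "run_product (\<lambda>i. coord i g)"
  let ?S = "SIGMA m:{1..n}. {A. A \<subseteq> {1..m-1} \<and> card A + k = m - 1}"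
  have g01: "fps_nth g 0 = 0" "coord 0 g = 1"
    using g by (auto simp: G_FdB_def coord_def)
  have pow0: "fps_nth (g ^ (k + 1)) 0 = 0"
    using g01 by (simp add: fps_power_zeroth)
  have "fps_nth (g ^ (Suc k + 1)) (n + 1) = (\<Sum>m=0..n+1. fps_nth (g ^ (k + 1)) m * fps_nth g (n + 1 - m))"
    by (simp only: add_Suc power_Suc2 fps_mult_nth)
  also have "\<dots> = (\<Sum>m=1..n. fps_nth (g ^ (k + 1)) m * fps_nth g (n + 1 - m))"
    by (rule sum.mono_neutral_right) (auto simp: g01 pow0 not_le not_less_eq_eq le_Suc_eq)
  also have "\<dots> = (\<Sum>m=1..n. \<Sum>A | A \<subseteq> {1..m-1} \<and> card A + k = m - 1. ?w A * coord (n - m) g)"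
  proof (rule sum.cong)
    fix m assume "m \<in> {1..n}"
    then show "fps_nth (g ^ (k + 1)) m * fps_nth g (n + 1 - m) =
        (\<Sum>A | A \<subseteq> {1..m-1} \<and> card A + k = m - 1. ?w A * coord (n - m) g)"
      using Suc.IH[of "m - 1"] by (simp add: coord_def sum_distrib_right Suc_diff_le)
  qed simp
  also have "\<dots> = (\<Sum>(m, A)\<in>?S. ?w A * coord (n - m) g)"
    by (rule sum.Sigma) (auto intro: finite_subset[of _ "Pow {1..n}"])
  also have "\<dots> = (\<Sum>A | A \<subseteq> {1..n} \<and> card A + Suc k = n. ?w A)"
  proof (rule sum.reindex_bij_witness[where j = "\<lambda>(m, A). A \<union> {m+1..n}"
        and i = "\<lambda>A. (Max ({1..n} - A), A \<inter> {1..<Max ({1..n} - A)})"])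
    fix p assume "p \<in> ?S"
    then obtain m A where p: "p = (m, A)" and m: "1 \<le> m" "m \<le> n"
      and A: "A \<subseteq> {1..m-1}" "card A + k = m - 1"
      by (cases p) auto
    have A_less: "A \<subseteq> {1..<m}" using A(1) m by (cases m) auto
    have "Max ({1..n} - (A \<union> {m+1..n})) = m"
      using m A_less by (intro Max_eqI) auto
    moreover have "(A \<union> {m+1..n}) \<inter> {1..<m} = A" using A_less by auto
    ultimately show "(\<lambda>A. (Max ({1..n} - A), A \<inter> {1..<Max ({1..n} - A)})) ((\<lambda>(m, A). A \<union> {m+1..n}) p) = p"
      by (simp add: p)
    have "card (A \<union> {m+1..n}) = card A + (n - m)"
      using A_less finite_subset[OF A_less] by (subst card_Un_disjoint) auto
    then show "(\<lambda>(m, A). A \<union> {m+1..n}) p \<in> {A. A \<subseteq> {1..n} \<and> card A + Suc k = n}"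
      using A A_less m by (auto simp: p)
    show "?w ((\<lambda>(m, A). A \<union> {m+1..n}) p) = (case p of (m, A) \<Rightarrow> ?w A * coord (n - m) g)"
      using run_product_after_gap[of m n A "\<lambda>i. coord i g"] m A_less g01 by (simp add: p)
  next
    fix A assume "A \<in> {A. A \<subseteq> {1..n} \<and> card A + Suc k = n}"
    then have A: "A \<subseteq> {1..n}" and card_A: "card A + Suc k = n" by auto
    define m where "m = Max ({1..n} - A)"
    have "card A < card {1..n}" using card_A by simp
    then have "{1..n} - A \<noteq> {}"
      using A by (metis Diff_eq_empty_iff less_irrefl subset_antisym)
    then have "m \<in> {1..n} - A" unfolding m_def by (intro Max_in) auto
    moreover have above: "{m+1..n} \<subseteq> A"
    proof
      fix i assume i: "i \<in> {m+1..n}"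
      show "i \<in> A"
      proof (rule ccontr)
        assume "i \<notin> A"
        with i have "i \<le> m" unfolding m_def by (intro Max_ge) auto
        with i show False by simp
      qed
    qed
    ultimately have m: "1 \<le> m" "m \<le> n" "m \<notin> A" by auto
    have split: "A = (A \<inter> {1..<m}) \<union> {m+1..n}"
    proof (intro set_eqI iffI)
      fix i assume "i \<in> A"
      then have "i \<in> {1..n}" "i \<noteq> m" using A m by auto
      with \<open>i \<in> A\<close> show "i \<in> (A \<inter> {1..<m}) \<union> {m+1..n}" by force
    qed (use above in auto)
    have "card A = card ((A \<inter> {1..<m}) \<union> {m+1..n})" using split by simp
    also have "\<dots> = card (A \<inter> {1..<m}) + (n - m)" by (subst card_Un_disjoint) auto
    finally have "card (A \<inter> {1..<m}) + k = m - 1" using card_A m by simp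
    then show "(Max ({1..n} - A), A \<inter> {1..<Max ({1..n} - A)}) \<in> ?S"
      unfolding m_def[symmetric] using m by auto
    show "(\<lambda>(m, A). A \<union> {m+1..n}) (Max ({1..n} - A), A \<inter> {1..<Max ({1..n} - A)}) = A"
      unfolding m_def[symmetric] using split by simp
  qed
  finally show ?case .
qed

lemma coord_fps_compose:
  fixes f g :: "'k::field_char_0 fps"
  assumes f: "f \<in> G_FdB" and g: "g \<in> G_FdB"
  shows "coord n (f oo g) =
    (\<Sum>A\<in>Pow {1..n}. coord (n - card A) f * run_product (\<lambda>i. coord i g) A)"
proof -
  let ?w = "run_product (\<lambda>i. coord i g)"
  have "coord n (f oo g) = (\<Sum>k=0..Suc n. fps_nth f k * fps_nth (g ^ k) (n + 1))"
    by (simp add: coord_def fps_compose_nth)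
  also have "\<dots> = (\<Sum>k=0..n. fps_nth f (k + 1) * fps_nth (g ^ (k + 1)) (n + 1))"
    using f by (subst sum.atLeast0_atMost_Suc_shift) (simp add: G_FdB_def)
  also have "\<dots> = (\<Sum>k=0..n. \<Sum>A | A \<in> Pow {1..n} \<and> n - card A = k. coord (n - card A) f * ?w A)"
  proof (rule sum.cong)
    fix k assume k: "k \<in> {0..n}"
    have "{A. A \<subseteq> {1..n} \<and> card A + k = n} = {A. A \<in> Pow {1..n} \<and> n - card A = k}"
      using k card_mono[of "{1..n}"] by force
    then show "fps_nth f (k + 1) * fps_nth (g ^ (k + 1)) (n + 1) =
        (\<Sum>A | A \<in> Pow {1..n} \<and> n - card A = k. coord (n - card A) f * ?w A)"
      unfolding fps_power_nth_eq_sum_run_product[OF g] sum_distrib_left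
      by (intro sum.cong) (auto simp: coord_def)
  qed simp
  also have "\<dots> = (\<Sum>A\<in>Pow {1..n}. coord (n - card A) f * ?w A)"
    by (rule sum.group) auto
  finally show ?thesis .
qed


section \<open>The coproduct of the Faa di Bruno Hopf algebra\<close>

text \<open>The value \<open>x\<^sub>0 = 1\<close> is the common leading coefficient of the series in \<open>G_FdB\<close>.\<close>

definition fdb_x0 :: "nat \<Rightarrow> 'k::field_char_0 H_FdB" where
  "fdb_x0 n = (if n = 0 then 1 else fdb_x n)"

lemma fdb_eval_x0:
  assumes "f \<in> G_FdB"
  shows "fdb_eval (fdb_x0 n) f = coord n f"
proof (cases "n = 0")
  case True
  then show ?thesis
    using assms algebra_hom_one[OF algebra_hom_fdb_eval, of f] by (simp add: fdb_x0_def coord_def G_FdB_def)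
next
  case False
  then show ?thesis
    by (simp add: fdb_x0_def fdb_x_def fdb_eval_def subst_gen[OF comm_algebra_mult] Abs_pos_inverse)
qed

definition fdb_coproduct_x :: "nat \<Rightarrow> ((pos \<Rightarrow>\<^sub>0 nat) \<times> (pos \<Rightarrow>\<^sub>0 nat) \<Rightarrow>\<^sub>0 'k::field_char_0)" where
  "fdb_coproduct_x n = (\<Sum>A\<in>Pow {1..n}. fdb_x0 (n - card A) \<otimes> run_product fdb_x0 A)"

lemma fdb_eval2_coproduct_x:
  assumes f: "f \<in> G_FdB" and g: "g \<in> G_FdB"
  shows "fdb_eval2 (fdb_coproduct_x n) f g = coord n (f oo g)"
proof -
  interpret Vector_Spaces.linear scale "(*)" "\<lambda>t. fdb_eval2 t f g"
    by (rule linear_fdb_eval2)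
  have "fdb_eval (run_product fdb_x0 A) g = run_product (\<lambda>i. coord i g) A" for A
    by (simp add: run_product_def algebra_hom_prod[OF algebra_hom_fdb_eval] fdb_eval_x0[OF g])
  then show ?thesis
    by (simp add: fdb_coproduct_x_def sum fdb_eval2_tensor fdb_eval_x0[OF f] coord_fps_compose[OF f g])
qed

lemma fdb_x_Rep_pos: "fdb_x (Rep_pos v) = gen v"
  by (simp add: fdb_x_def Rep_pos_inverse)

lemma fdb_coproduct_eq_subst:
  "(fdb_coproduct :: 'k::field_char_0 H_FdB \<Rightarrow> _) = subst scale (\<lambda>v. fdb_coproduct_x (Rep_pos v))"
proof -
  let ?D = "subst scale (\<lambda>v. fdb_coproduct_x (Rep_pos v)) :: 'k H_FdB \<Rightarrow> _"
  have hom: "algebra_hom scale scale ?D"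
    by (rule algebra_hom_subst[OF comm_algebra_scale])
  show ?thesis
    unfolding fdb_coproduct_def
  proof (rule the_equality)
    show "algebra_hom scale scale ?D \<and>
        (\<forall>n\<ge>1. \<forall>f\<in>G_FdB. \<forall>g\<in>G_FdB. fdb_eval2 (?D (fdb_x n)) f g = coord n (f oo g))"
      using hom by (auto simp: fdb_x_def subst_gen[OF comm_algebra_scale] Abs_pos_inverse fdb_eval2_coproduct_x)
  next
    fix D :: "'k H_FdB \<Rightarrow> _"
    assume D: "algebra_hom scale scale D \<and>
        (\<forall>n\<ge>1. \<forall>f\<in>G_FdB. \<forall>g\<in>G_FdB. fdb_eval2 (D (fdb_x n)) f g = coord n (f oo g))"
    have "D (gen v) = ?D (gen v)" for v
      using D[THEN conjunct2, rule_format, OF Rep_pos_ge_1[of v]]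
      by (intro fdb_eval2_inject)
        (simp add: fdb_x_Rep_pos subst_gen[OF comm_algebra_scale] fdb_eval2_coproduct_x)
    then show "D = ?D"
      using algebra_hom_eqI[OF _ hom, of D] D by blast
  qed
qed

lemma algebra_hom_fdb_coproduct: "algebra_hom scale scale fdb_coproduct"
  unfolding fdb_coproduct_eq_subst by (rule algebra_hom_subst[OF comm_algebra_scale])

lemma fdb_coproduct_gen: "fdb_coproduct (gen v) = fdb_coproduct_x (Rep_pos v)"
  unfolding fdb_coproduct_eq_subst by (rule subst_gen[OF comm_algebra_scale])

text \<open>The grading of the polynomial algebra in which \<open>x\<^sub>n\<close> has degree \<open>n\<close>.\<close>

definition fdb_weight :: "(pos \<Rightarrow>\<^sub>0 nat) \<Rightarrow> nat" where
  "fdb_weight m = (\<Sum>v\<in>Poly_Mapping.keys m. Rep_pos v * Poly_Mapping.lookup m v)"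

lemma fdb_weight_superset:
  "finite A \<Longrightarrow> Poly_Mapping.keys m \<subseteq> A \<Longrightarrow> fdb_weight m = (\<Sum>v\<in>A. Rep_pos v * Poly_Mapping.lookup m v)"
  unfolding fdb_weight_def by (rule sum.mono_neutral_left) (auto simp: in_keys_iff)

lemma fdb_weight_0 [simp]: "fdb_weight 0 = 0"
  by (simp add: fdb_weight_def)

lemma fdb_weight_var [simp]: "fdb_weight (Poly_Mapping.single v (Suc 0)) = Rep_pos v"
  by (subst fdb_weight_superset[of "{v}"]) auto

lemma fdb_weight_add [simp]: "fdb_weight (m + n) = fdb_weight m + fdb_weight n"
  using keys_add[of m n]
  by (simp add: fdb_weight_superset[of "Poly_Mapping.keys m \<union> Poly_Mapping.keys n"] lookup_add
      algebra_simps sum.distrib)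

definition left_weight_below :: "nat \<Rightarrow> ((pos \<Rightarrow>\<^sub>0 nat) \<times> (pos \<Rightarrow>\<^sub>0 nat) \<Rightarrow>\<^sub>0 'k::zero) \<Rightarrow> bool" where
  "left_weight_below d t \<longleftrightarrow> (\<forall>(a, b)\<in>Poly_Mapping.keys t. fdb_weight a < d)"

lemma left_weight_below_add:
  "left_weight_below d t \<Longrightarrow> left_weight_below d u \<Longrightarrow> left_weight_below d (t + u)"
  using keys_add[of t u] unfolding left_weight_below_def by blast

lemma left_weight_below_sum:
  "(\<And>i. i \<in> I \<Longrightarrow> left_weight_below d (t i)) \<Longrightarrow> left_weight_below d (\<Sum>i\<in>I. t i)"
proof (induction I rule: infinite_finite_induct)
  case (insert i I)
  then show ?case by (simp add: left_weight_below_add)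
qed (simp_all add: left_weight_below_def)

lemma left_weight_below_mult:
  fixes t u :: "_ \<Rightarrow>\<^sub>0 'k::comm_ring_1"
  assumes "left_weight_below d t" "left_weight_below e u"
  shows "left_weight_below (d + e) (t * u)"
  using keys_mult[of t u] assms unfolding left_weight_below_def by (fastforce intro: add_strict_mono)

lemma left_weight_below_mult_monomial:
  fixes t :: "_ \<Rightarrow>\<^sub>0 'k::comm_ring_1"
  assumes "left_weight_below d t"
  shows "left_weight_below (d + fdb_weight m) (t * monomial (m, 0))"
  using keys_mult[of t "monomial (m, 0)"] assms unfolding left_weight_below_def by fastforce

text \<open>
  Only the subset \<open>A = {}\<close> contributes \<open>x\<^sub>n \<otimes> 1\<close> to the coproduct of \<open>x\<^sub>n\<close>, and every other subset
  has left factor \<open>x\<^bsub>n-|A|\<^esub>\<close> of smaller degree. This shape is inherited by products.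
\<close>

lemma fdb_coproduct_triangular:
  "left_weight_below (fdb_weight m) (fdb_coproduct (monomial m) - (monomial (m, 0) :: _ \<Rightarrow>\<^sub>0 'k::field_char_0))"
proof (induction m rule: monom_induct)
  case zero
  show ?case
    by (simp add: left_weight_below_def single_one algebra_hom_one[OF algebra_hom_fdb_coproduct]
        flip: zero_prod_def)
next
  case (var v)
  let ?n = "Rep_pos v"
  have "fdb_x0 ?n \<otimes> run_product fdb_x0 {} = (monomial (Poly_Mapping.single v 1, 0) :: _ \<Rightarrow>\<^sub>0 'k)"
    using Rep_pos_ge_1[of v]
    by (simp add: run_product_def fdb_x0_def fdb_x_Rep_pos gen_def flip: single_one)
  moreover have "fdb_coproduct (monomial (Poly_Mapping.single v 1)) = fdb_x0 ?n \<otimes> run_product fdb_x0 {} +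
      (\<Sum>A\<in>Pow {1..?n} - {{}}. fdb_x0 (?n - card A) \<otimes> (run_product fdb_x0 A :: 'k H_FdB))"
    unfolding gen_def[symmetric] fdb_coproduct_gen fdb_coproduct_x_def by (subst sum.remove[of _ "{}"]) auto
  ultimately have "fdb_coproduct (monomial (Poly_Mapping.single v 1)) - monomial (Poly_Mapping.single v 1, 0) =
      (\<Sum>A\<in>Pow {1..?n} - {{}}. fdb_x0 (?n - card A) \<otimes> (run_product fdb_x0 A :: 'k H_FdB))"
    by simp
  moreover have "left_weight_below ?n (fdb_x0 (?n - card A) \<otimes> (run_product fdb_x0 A :: 'k H_FdB))"
    if A: "A \<in> Pow {1..?n} - {{}}" for A
  proof -
    define m where "m = (if ?n - card A = 0 then 0 else Poly_Mapping.single (Abs_pos (?n - card A)) (Suc 0))"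
    have x: "fdb_x0 (?n - card A) = (monomial m :: 'k H_FdB)"
      by (simp add: m_def fdb_x0_def fdb_x_def gen_def single_one)
    have "finite A" using A finite_subset by blast
    then have "card A > 0" using A by (simp add: card_gt_0_iff)
    then have "fdb_weight m < ?n"
      using Rep_pos_ge_1[of v] by (auto simp: m_def Abs_pos_inverse)
    moreover have "a = m" if "(a, b) \<in> Poly_Mapping.keys (monomial m \<otimes> q)" for a b and q :: "'k H_FdB"
      using that by (auto simp: in_keys_iff lookup_tensor lookup_single when_def split: if_splits)
    ultimately show ?thesis unfolding x left_weight_below_def by auto
  qed
  ultimately show ?case
    unfolding fdb_weight_var One_nat_def by (metis (no_types, lifting) left_weight_below_sum)
next
  case (add m n)
  let ?M = "monomial (m, 0) :: _ \<Rightarrow>\<^sub>0 'k" and ?N = "monomial (n, 0) :: _ \<Rightarrow>\<^sub>0 'k"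
  define l where "l = fdb_coproduct (monomial m) - ?M"
  define l' where "l' = fdb_coproduct (monomial n) - ?N"
  have "fdb_coproduct (monomial (m + n)) = fdb_coproduct (monomial m * monomial n :: 'k H_FdB)"
    by (simp add: mult_single)
  also have "\<dots> = (?M + l) * (?N + l')"
    by (simp add: algebra_hom_mult[OF algebra_hom_fdb_coproduct] l_def l'_def)
  also have "\<dots> = monomial (m + n, 0) + (l * l' + (l * ?N + l' * ?M))"
    by (simp add: algebra_simps mult_single)
  finally have "fdb_coproduct (monomial (m + n)) - monomial (m + n, 0) = l * l' + (l * ?N + l' * ?M)"
    by simp
  moreover have "left_weight_below (fdb_weight m + fdb_weight n) (l' * ?M)"
    using left_weight_below_mult_monomial[of "fdb_weight n" l' m] add.IH(2) by (simp add: l'_def add.commute)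
  ultimately show ?case
    using add.IH
    by (auto simp: l_def l'_def intro!: left_weight_below_add left_weight_below_mult left_weight_below_mult_monomial)
qed


section \<open>Partitions into singletons\<close>

text \<open>The value \<open>J\<^sub>0 = 1\<close> accounts for the restriction to the empty set of blocks.\<close>

definition J0 :: "nat \<Rightarrow> 'k::field_char_0 ncp_alg" where
  "J0 n = (if n = 0 then 1 else gen (J_ncp n))"

abbreviation points :: "nat set \<Rightarrow> nat set set" where
  "points A \<equiv> (\<lambda>i. {i}) ` A"

lemma blocks_J_ncp_points: "n \<ge> 1 \<Longrightarrow> blocks (J_ncp n) = points {1..n}"
  by (simp add: blocks_J_ncp singletons_def)

text \<open>The nesting order of a partition into singletons is equality.\<close>

lemma ideals_J_ncp: "n \<ge> 1 \<Longrightarrow> ideals (J_ncp n) = points ` Pow {1..n}"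
  unfolding ideals_def blocks_J_ncp_points image_Pow_surj[OF refl]
  by (auto simp: nesting_le_def)

lemma restrict_blocks_points:
  assumes n: "n \<ge> 1" and A: "A \<subseteq> {1..n}"
  shows "restrict_blocks (points A) = J0 (card A)"
proof (cases "A = {}")
  case False
  have Union: "\<Union>(points A) = A" by auto
  have part: "partition_on {1..card A} (renumber (points A))"
    using renumber_noncrossing(1)[of "points A" "J_ncp n"] n A False
    by (simp add: blocks_J_ncp_points Union image_mono)
  \<comment> \<open>Renumbering maps singletons to singletons, and only one partition consists of singletons.\<close>
  have single: "\<exists>i. b = {i}" if "b \<in> renumber (points A)" for b
    using that by (auto simp: renumber_def)
  have "renumber (points A) = points (\<Union>(renumber (points A)))"
  proof (intro set_eqI iffI)
    fix b assume b: "b \<in> renumber (points A)"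
    with single obtain i where "b = {i}" by blast
    with b show "b \<in> points (\<Union>(renumber (points A)))" by blast
  next
    fix b assume "b \<in> points (\<Union>(renumber (points A)))"
    then obtain i c where "b = {i}" "i \<in> c" "c \<in> renumber (points A)" by blast
    with single[of c] show "b \<in> renumber (points A)" by auto
  qed
  then have "renumber (points A) = singletons (card A)"
    using partition_onD1[OF part] by (simp add: singletons_def)
  moreover have "card A \<noteq> 0"
    using False A finite_subset by fastforce
  ultimately show ?thesis
    using False by (simp add: restrict_blocks_def J0_def J_ncp_def)
qed (simp add: restrict_blocks_def J0_def)

lemma restrict_dot_points:
  assumes n: "n \<ge> 1" and A: "A \<subseteq> {1..n}"
  shows "restrict_dot (J_ncp n) (points A) = (run_product J0 A :: 'k::field_char_0 ncp_alg)"
proof -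
  have "restrict_blocks {b \<in> blocks (J_ncp n). b \<subseteq> I} = (J0 (card I) :: 'k ncp_alg)"
    if "I \<in> runs A" for I
  proof -
    have I: "I \<subseteq> {1..n}" using that A by (auto simp: runs_def)
    then have "{b \<in> blocks (J_ncp n). b \<subseteq> I} = points I"
      using n by (auto simp: blocks_J_ncp_points)
    then show ?thesis using restrict_blocks_points[OF n I] by simp
  qed
  moreover have "\<Union>(points A) = A" by auto
  ultimately show ?thesis by (simp add: restrict_dot_def run_product_def)
qed

lemma ncp_coproduct_J_ncp:
  assumes n: "n \<ge> 1"
  shows "ncp_coproduct (gen (J_ncp n)) = (\<Sum>A\<in>Pow {1..n}. J0 (n - card A) \<otimes> run_product J0 A)"
proof -
  have inj: "inj_on points (Pow {1..n})"
    by (rule inj_onI) auto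
  have "ncp_coproduct (gen (J_ncp n)) =
      (\<Sum>A\<in>Pow {1..n}. restrict_blocks (blocks (J_ncp n) - points A) \<otimes> restrict_dot (J_ncp n) (points A))"
    unfolding ncp_coproduct_def
    unfolding subst_gen[OF comm_algebra_scale] ideals_J_ncp[OF n] sum.reindex[OF inj] by simp
  also have "\<dots> = (\<Sum>A\<in>Pow {1..n}. J0 (n - card A) \<otimes> run_product J0 A)"
  proof (rule sum.cong)
    fix A assume A: "A \<in> Pow {1..n}"
    have "blocks (J_ncp n) - points A = points ({1..n} - A)"
      using n by (auto simp: blocks_J_ncp_points)
    moreover have "card ({1..n} - A) = n - card A"
      using A by (simp add: card_Diff_subset finite_subset)
    ultimately show "restrict_blocks (blocks (J_ncp n) - points A) \<otimes> restrict_dot (J_ncp n) (points A) =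
        J0 (n - card A) \<otimes> run_product J0 A"
      using A n by (simp add: restrict_blocks_points[OF n] restrict_dot_points)
  qed simp
  finally show ?thesis .
qed


section \<open>The morphism\<close>

lemma algebra_hom_Phi_FdB: "algebra_hom scale scale Phi_FdB"
  unfolding Phi_FdB_def by (rule algebra_hom_subst[OF comm_algebra_scale])

lemma Phi_FdB_gen: "Phi_FdB (gen v) = gen (J_ncp (Rep_pos v))"
  unfolding Phi_FdB_def by (rule subst_gen[OF comm_algebra_scale])

lemma Phi_FdB_x: "n \<ge> 1 \<Longrightarrow> Phi_FdB (fdb_x n) = gen (J_ncp n)"
  by (simp add: fdb_x_def Phi_FdB_gen Abs_pos_inverse)

lemma Phi_FdB_x0: "Phi_FdB (fdb_x0 n) = J0 n"
  by (simp add: fdb_x0_def J0_def Phi_FdB_x algebra_hom_one[OF algebra_hom_Phi_FdB])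

lemma Phi_FdB_coproduct:
  fixes p :: "'k::field_char_0 H_FdB"
  shows "ncp_coproduct (Phi_FdB p) = tensor_map Phi_FdB Phi_FdB (fdb_coproduct p)"
proof (rule algebra_hom_eqI[where F = "\<lambda>p. ncp_coproduct (Phi_FdB p)"
      and G = "\<lambda>p. tensor_map Phi_FdB Phi_FdB (fdb_coproduct p)"])
  have tensor_hom: "algebra_hom scale scale (tensor_map Phi_FdB (Phi_FdB :: 'k H_FdB \<Rightarrow> _))"
    by (rule algebra_hom_tensor_map[OF algebra_hom_Phi_FdB algebra_hom_Phi_FdB])
  have "algebra_hom scale scale (ncp_coproduct :: 'k ncp_alg \<Rightarrow> _)"
    unfolding ncp_coproduct_def by (rule algebra_hom_subst[OF comm_algebra_scale])
  then show "algebra_hom scale scale (\<lambda>p :: 'k H_FdB. ncp_coproduct (Phi_FdB p))"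
    by (rule algebra_hom_compose[OF algebra_hom_Phi_FdB])
  show "algebra_hom scale scale (\<lambda>p :: 'k H_FdB. tensor_map Phi_FdB Phi_FdB (fdb_coproduct p))"
    by (rule algebra_hom_compose[OF algebra_hom_fdb_coproduct tensor_hom])
  fix v
  interpret Vector_Spaces.linear scale scale "tensor_map Phi_FdB (Phi_FdB :: 'k H_FdB \<Rightarrow> _)"
    by (rule linear_tensor_map)
  note linear = algebra_hom_linear[OF algebra_hom_Phi_FdB]
  have "Phi_FdB (run_product fdb_x0 A) = (run_product J0 A :: 'k ncp_alg)" for A
    by (simp add: run_product_def algebra_hom_prod[OF algebra_hom_Phi_FdB] Phi_FdB_x0)
  then show "ncp_coproduct (Phi_FdB (gen v)) = tensor_map Phi_FdB Phi_FdB (fdb_coproduct (gen v :: 'k H_FdB))"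
    by (simp add: Phi_FdB_gen ncp_coproduct_J_ncp[OF Rep_pos_ge_1] fdb_coproduct_gen fdb_coproduct_x_def
        sum tensor_map_tensor[OF linear linear] Phi_FdB_x0)
qed

lemma Phi_FdB_counit:
  fixes p :: "'k::field_char_0 H_FdB"
  shows "ncp_counit (Phi_FdB p) = fdb_counit p"
proof (rule algebra_hom_eqI[where F = "\<lambda>p. ncp_counit (Phi_FdB p)" and G = fdb_counit])
  have counit: "algebra_hom scale (*) (ncp_counit :: 'k ncp_alg \<Rightarrow> _)"
    unfolding ncp_counit_def by (rule algebra_hom_subst[OF comm_algebra_mult])
  show "algebra_hom scale (*) (\<lambda>p :: 'k H_FdB. ncp_counit (Phi_FdB p))"
    by (rule algebra_hom_compose[OF algebra_hom_Phi_FdB counit])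
  show "algebra_hom scale (*) (fdb_counit :: 'k H_FdB \<Rightarrow> _)"
    unfolding fdb_counit_def by (rule algebra_hom_fdb_eval)
  show "ncp_counit (Phi_FdB (gen v)) = (fdb_counit (gen v) :: 'k)" for v
    using Rep_pos_ge_1[of v]
    by (simp add: Phi_FdB_gen ncp_counit_def fdb_counit_def fdb_eval_def subst_gen[OF comm_algebra_mult] coord_def)
qed

theorem proposition2p8:
  shows "(\<forall>n\<ge>1. Phi_FdB (fdb_x n :: 'k::field_char_0 H_FdB) = gen (J_ncp n)) \<and>
    hopf_algebra_hom fdb_coproduct fdb_counit ncp_coproduct ncp_counit
      (Phi_FdB :: 'k H_FdB \<Rightarrow> 'k ncp_alg)"
proof (intro conjI allI impI)
  show "Phi_FdB (fdb_x n :: 'k H_FdB) = gen (J_ncp n)" if "n \<ge> 1" for n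
    using that by (rule Phi_FdB_x)
  have "Phi_FdB (S p) = S' (Phi_FdB p)"
    if "is_antipode fdb_coproduct fdb_counit S" "is_antipode ncp_coproduct ncp_counit S'"
    for S and S' and p :: "'k H_FdB"
    using fdb_coproduct_triangular unfolding left_weight_below_def
    by (intro bialgebra_hom_commutes_with_antipode[where wt = fdb_weight, OF algebra_hom_Phi_FdB Phi_FdB_coproduct Phi_FdB_counit _ that])
      blast
  then show "hopf_algebra_hom fdb_coproduct fdb_counit ncp_coproduct ncp_counit
      (Phi_FdB :: 'k H_FdB \<Rightarrow> 'k ncp_alg)"
    unfolding hopf_algebra_hom_def
    using algebra_hom_Phi_FdB Phi_FdB_coproduct Phi_FdB_counit by blast
qed

end
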